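(* Let $(X,Y,Z)$ be random variables with $X,Y\in\{0,1\}$ and $Z\in\{0,1,\bot\}$, whose joint distribution $P$ is given by the matrices $M_z=(P(X=x,Y=y,Z=z))_{x,y\in\{0,1\}}$ (rows indexed by $x$, columns by $y$) $$M_0=\frac1{36}\begin{pmatrix}5&2\\2&0\end{pmatrix},\qquad M_1=\frac1{36}\begin{pmatrix}0&2\\2&5\end{pmatrix},\qquad M_\bot=\frac1{36}\begin{pmatrix}5&4\\4&5\end{pmatrix}.$$ Then $$S(X;Y\Vert Z)=0<I(X;Y{\downarrow}Z)\le I_{\rm form}(X;Y\mid Z),$$ where $S$ is the secret-key rate, $I(X;Y{\downarrow}Z)$ the intrinsic information and $I_{\rm form}$ the formation cost.
   Context: All alphabets are finite and logarithms are base two. $I(\cdot;\cdot)$ and $I(\cdot;\cdot\mid\cdot)$ are (conditional) mutual information, $H$ is Shannon entropy. Secret-key rate. Let $(X,Y,Z)$ have a joint distribution on finite alphabets. An $n$-copy protocol: Alice holds $X^n$, Bob holds $Y^n$, Eve holds $Z^n$, where $(X^n,Y^n,Z^n)$ are $n$ i.i.d. copies of $(X,Y,Z)$. Alice and Bob have private local randomness (independent of each other and of the source) and exchange an arbitrary finite number of rounds of public messages, each message being a function of the sender's data, the sender's private randomness and the previous messages; $F$ denotes the full public transcript. At the end Alice computes $K_A$ and Bob computes $K_B$, with values in a finite set $\mathcal K_n$, from their own data, randomness and $F$. A sequence of such protocols is admissible if, as $n\to\infty$, $\Pr[K_A=K_B]\to1$, $\log|\mathcal K_n|-H(K_A)\to0$,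 and $I(K_A;Z^n,F)\to0$; its rate is $\liminf_{n\to\infty}\frac1n\log|\mathcal K_n|$. $S(X;Y\Vert Z)$ is the supremum of the rates of admissible sequences. Intrinsic information. $I(X;Y{\downarrow}Z):=\inf_{P_{\bar Z\mid Z}}I(X;Y\mid\bar Z)$, the infimum over all channels (stochastic maps) from the alphabet of $Z$ to finite alphabets, where $\bar Z$ is obtained by applying the channel to $Z$ (so $(X,Y)-Z-\bar Z$ is a Markov chain). Formation cost. $I_{\rm form}(X;Y\mid Z)$ is the minimal rate of pre-shared secret bits needed to generate samples of $(X,Y)$ by public discussion while ensuring that the public transcript can be simulated from $Z$. Precisely: it is the infimum of all $R\ge0$ such that for every $\varepsilon>0$ and all sufficiently large $N$ there is an interactive public-discussion protocol in which Alice and Bob start with $\lfloor RN\rfloor$ shared uniform secret bits and private local randomness, exchange a public transcript $C$, and output $\tilde X^N$ and $\tilde Y^N$ respectively, and there is a channel $P_{\bar C\mid Z^N}$, such that the law of $(\tilde X^N,\tilde Y^N,C)$ is within total variation distance $\varepsilon$ of the law of $(X^N,Y^N,\bar C)$, where $(X^N,Y^N,Z^N)$ are $N$ i.i.d. copies of $(X,Y,Z)$ and $\bar C$ is obtained from $Z^N$ through this channel. *)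

theory Defs
  imports "HOL-Probability.Probability"
begin

section \<open>Information measures of discrete laws\<close>

text \<open>
  All three are in bits. The types that occur below are countable, so products of counting
  measures are again counting measures.
\<close>

abbreviation entropy2 :: "'a pmf \<Rightarrow> ('a \<Rightarrow> 'b) \<Rightarrow> real" where
  "entropy2 p X \<equiv> prob_space.entropy (measure_pmf p) 2 (count_space UNIV) X"

abbreviation mutual_info2 :: "'a pmf \<Rightarrow> ('a \<Rightarrow> 'b) \<Rightarrow> ('a \<Rightarrow> 'c) \<Rightarrow> real" where
  "mutual_info2 p X Y \<equiv>
     prob_space.mutual_information (measure_pmf p) 2 (count_space UNIV) (count_space UNIV) X Y"

abbreviation cond_mutual_info2 ::
    "'a pmf \<Rightarrow> ('a \<Rightarrow> 'b) \<Rightarrow> ('a \<Rightarrow> 'c) \<Rightarrow> ('a \<Rightarrow> 'd) \<Rightarrow> real" where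
  "cond_mutual_info2 p X Y Z \<equiv>
     prob_space.conditional_mutual_information (measure_pmf p) 2
       (count_space UNIV) (count_space UNIV) (count_space UNIV) X Y Z"

definition tv_dist :: "'a pmf \<Rightarrow> 'a pmf \<Rightarrow> real" where
  "tv_dist p q = (SUP A. \<bar>measure_pmf.prob p A - measure_pmf.prob q A\<bar>)"

text \<open>
  A channel is only ever applied to a finite input alphabet, so that finite support for each
  input letter amounts to a finite output alphabet. Output letters are coded in a countably
  infinite type, so that finite alphabets of every size occur.
\<close>

definition finite_channel :: "('a \<Rightarrow> 'b pmf) \<Rightarrow> bool" where
  "finite_channel W \<longleftrightarrow> (\<forall>a. finite (set_pmf (W a)))"


section \<open>Interactive public discussion\<close>

text \<open>
  A message is computed from the sender's input, the sender's private randomness and the list of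
  all previous messages (oldest first). Private randomness and messages are coded by natural
  numbers; a protocol is a list of messages, of any length and with any order of the senders.
  As inputs and private randomness range over finite alphabets, so do the messages.
\<close>

datatype ('a, 'b) message =
    From_Alice "'a \<Rightarrow> nat \<Rightarrow> nat list \<Rightarrow> nat"
  | From_Bob "'b \<Rightarrow> nat \<Rightarrow> nat list \<Rightarrow> nat"

record ('a, 'b, 'k, 'l) protocol =
  rand_A :: "nat pmf"
  rand_B :: "nat pmf"
  messages :: "('a, 'b) message list"
  out_A :: "'a \<Rightarrow> nat \<Rightarrow> nat list \<Rightarrow> 'k"
  out_B :: "'b \<Rightarrow> nat \<Rightarrow> nat list \<Rightarrow> 'l"

definition finite_randomness :: "('a, 'b, 'k, 'l) protocol \<Rightarrow> bool" where
  "finite_randomness \<pi> \<longleftrightarrow> finite (set_pmf (rand_A \<pi>)) \<and> finite (set_pmf (rand_B \<pi>))"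

text \<open>The last argument is the list of messages sent so far.\<close>

fun transcript ::
    "('a, 'b) message list \<Rightarrow> 'a \<Rightarrow> nat \<Rightarrow> 'b \<Rightarrow> nat \<Rightarrow> nat list \<Rightarrow> nat list" where
  "transcript [] a r b s h = h"
| "transcript (From_Alice f # ms) a r b s h = transcript ms a r b s (h @ [f a r h])"
| "transcript (From_Bob g # ms) a r b s h = transcript ms a r b s (h @ [g b s h])"

text \<open>Joint law of Alice's output, Bob's output and the transcript, for given inputs.\<close>

definition run :: "('a, 'b, 'k, 'l) protocol \<Rightarrow> 'a \<Rightarrow> 'b \<Rightarrow> ('k \<times> 'l \<times> nat list) pmf" where
  "run \<pi> a b =
     do {
       r \<leftarrow> rand_A \<pi>;
       s \<leftarrow> rand_B \<pi>;
       let c = transcript (messages \<pi>) a r b s [];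
       return_pmf (out_A \<pi> a r c, out_B \<pi> b s c, c)
     }"


section \<open>Secret-key rate\<close>

text \<open>Joint law of \<open>K\<^sub>A\<close>, \<open>K\<^sub>B\<close>, \<open>Z\<^sup>n\<close> and \<open>F\<close>.\<close>

definition key_law ::
    "('x \<times> 'y \<times> 'z) pmf \<Rightarrow> nat \<Rightarrow> ('x list, 'y list, nat, nat) protocol
      \<Rightarrow> (nat \<times> nat \<times> 'z list \<times> nat list) pmf" where
  "key_law P n \<pi> =
     do {
       xyz \<leftarrow> replicate_pmf n P;
       (ka, kb, f) \<leftarrow> run \<pi> (map fst xyz) (map (fst \<circ> snd) xyz);
       return_pmf (ka, kb, map (snd \<circ> snd) xyz, f)
     }"

definition admissible ::
    "('x::finite \<times> 'y::finite \<times> 'z::finite) pmf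
      \<Rightarrow> (nat \<Rightarrow> ('x list, 'y list, nat, nat) protocol) \<Rightarrow> (nat \<Rightarrow> nat set) \<Rightarrow> bool" where
  "admissible P \<pi> K \<longleftrightarrow>
     (\<forall>n. finite_randomness (\<pi> n) \<and> finite (K n)
        \<and> (\<forall>a r c. out_A (\<pi> n) a r c \<in> K n) \<and> (\<forall>b s c. out_B (\<pi> n) b s c \<in> K n))
     \<and> (\<lambda>n. measure_pmf.prob (key_law P n (\<pi> n)) {(ka, kb, z, f). ka = kb}) \<longlonglongrightarrow> 1
     \<and> (\<lambda>n. log 2 (real (card (K n))) - entropy2 (key_law P n (\<pi> n)) fst) \<longlonglongrightarrow> 0
     \<and> (\<lambda>n. mutual_info2 (key_law P n (\<pi> n)) fst (snd \<circ> snd)) \<longlonglongrightarrow> 0"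

definition secret_key_rate :: "('x::finite \<times> 'y::finite \<times> 'z::finite) pmf \<Rightarrow> ereal" where
  "secret_key_rate P =
     Sup {liminf (\<lambda>n. ereal (log 2 (real (card (K n))) / real n)) | \<pi> K. admissible P \<pi> K}"


section \<open>Intrinsic information\<close>

definition intrinsic_information :: "('x::finite \<times> 'y::finite \<times> 'z::finite) pmf \<Rightarrow> ereal" where
  "intrinsic_information P =
     (INF W \<in> {W :: 'z \<Rightarrow> nat pmf. finite_channel W}.
        ereal (cond_mutual_info2
          (do { (x, y, z) \<leftarrow> P; z' \<leftarrow> W z; return_pmf (x, y, z') })
          fst (fst \<circ> snd) (snd \<circ> snd)))"


section \<open>Formation cost\<close>

text \<open>Joint law of Alice's output, Bob's output and the transcript, from \<open>k\<close> shared secret bits.\<close>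

definition formation_law ::
    "nat \<Rightarrow> (bool list, bool list, 'x list, 'y list) protocol
      \<Rightarrow> ('x list \<times> 'y list \<times> nat list) pmf" where
  "formation_law k \<pi> =
     do { u \<leftarrow> pmf_of_set {u :: bool list. length u = k}; run \<pi> u u }"

definition simulated_law ::
    "('x \<times> 'y \<times> 'z) pmf \<Rightarrow> nat \<Rightarrow> ('z list \<Rightarrow> nat list pmf)
      \<Rightarrow> ('x list \<times> 'y list \<times> nat list) pmf" where
  "simulated_law P N Q =
     do {
       xyz \<leftarrow> replicate_pmf N P;
       c \<leftarrow> Q (map (snd \<circ> snd) xyz);
       return_pmf (map fst xyz, map (fst \<circ> snd) xyz, c)
     }"

definition formation_achievable ::
    "('x::finite \<times> 'y::finite \<times> 'z::finite) pmf \<Rightarrow> real \<Rightarrow> bool" where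
  "formation_achievable P R \<longleftrightarrow>
     (\<forall>\<epsilon>>0. \<forall>\<^sub>F N in sequentially.
        \<exists>(\<pi> :: (bool list, bool list, 'x list, 'y list) protocol) Q.
          finite_randomness \<pi>
          \<and> (\<forall>a r c. length (out_A \<pi> a r c) = N) \<and> (\<forall>b s c. length (out_B \<pi> b s c) = N)
          \<and> finite_channel Q
          \<and> tv_dist (formation_law (nat \<lfloor>R * real N\<rfloor>) \<pi>) (simulated_law P N Q) \<le> \<epsilon>)"

definition formation_cost :: "('x::finite \<times> 'y::finite \<times> 'z::finite) pmf \<Rightarrow> ereal" where
  "formation_cost P = Inf {ereal R | R. 0 \<le> R \<and> formation_achievable P R}"

end

theory Submission
  imports Defs
begin

text \<open>
  The source has a latent bit \<open>T\<close>, equal to the common value if \<open>X = Y\<close> and to a fair coin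
  otherwise, and \<open>Z\<close> is \<open>T\<close> sent through an erasure channel with erasure probability 1/2.
  Sending \<open>T\<close> instead through a binary symmetric channel with crossover probability 1/5 gives a
  bit \<open>J\<close> conditioned on which \<open>X\<close> and \<open>Y\<close> are independent. As 1/2 \<open>\<le>\<close> 4 (1/5) (4/5), the variable
  \<open>Z\<close> is less noisy than \<open>J\<close>, although \<open>J\<close> is not a degraded version of \<open>Z\<close>, and this passes to
  n copies. Hence a key that is secret from \<open>Z\<^sup>n\<close> and the transcript \<open>F\<close> is also secret from an
  eavesdropper holding \<open>J\<^sup>n\<close>; but given \<open>J\<^sup>n\<close> and \<open>F\<close> the two keys are independent, so keys that
  agree have bounded length.

  For the intrinsic information, an output letter of a channel with input weights \<open>a\<close>, \<open>b\<close>, \<open>c\<close>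
  (from 0, 1, \<open>\<bottom>\<close>) makes \<open>X\<close> and \<open>Y\<close> independent only if \<open>u = 4 v\<close> or \<open>v = 4 u\<close>, where \<open>u = a + c\<close>
  and \<open>v = b + c\<close>. The information is bounded below, letter by letter, by a linear function of the
  weights whose total is positive.

  For the formation cost, discussion cannot increase the information \<open>\<lfloor>R N\<rfloor>\<close> shared at the start,
  conditional information is continuous uniformly in the alphabet of the transcript, and by the
  chain rule the information of N copies given a simulated transcript is at least N times the
  intrinsic information.
\<close>

section \<open>Entropies of finitely supported laws\<close>

text \<open>Probabilities of fibres are taken on the sample space rather than on values. An entropy
  then depends on a variable only through the partition it induces on the support, and value types
  need not be countable or finite.\<close>

definition cell :: "'a pmf \<Rightarrow> ('a \<Rightarrow> 'b) \<Rightarrow> 'a \<Rightarrow> real" where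
  "cell p X a = measure_pmf.prob p {b. X b = X a}"

definition ent :: "'a pmf \<Rightarrow> ('a \<Rightarrow> 'b) \<Rightarrow> real" where
  "ent p X = (\<Sum>a\<in>set_pmf p. pmf p a * - log 2 (cell p X a))"

definition mi :: "'a pmf \<Rightarrow> ('a \<Rightarrow> 'b) \<Rightarrow> ('a \<Rightarrow> 'c) \<Rightarrow> real" where
  "mi p X Y = ent p X + ent p Y - ent p (\<lambda>a. (X a, Y a))"

definition cmi :: "'a pmf \<Rightarrow> ('a \<Rightarrow> 'b) \<Rightarrow> ('a \<Rightarrow> 'c) \<Rightarrow> ('a \<Rightarrow> 'd) \<Rightarrow> real" where
  "cmi p X Y Z = ent p (\<lambda>a. (X a, Z a)) + ent p (\<lambda>a. (Y a, Z a))
     - ent p (\<lambda>a. (X a, Y a, Z a)) - ent p Z"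

lemma prob_eq_sum:
  assumes "finite (set_pmf p)"
  shows "measure_pmf.prob p A = (\<Sum>a\<in>set_pmf p. if a \<in> A then pmf p a else 0)"
proof -
  have "measure_pmf.prob p A = measure_pmf.prob p (A \<inter> set_pmf p)"
    by (simp add: measure_Int_set_pmf)
  also have "\<dots> = (\<Sum>a\<in>A \<inter> set_pmf p. pmf p a)"
    using assms by (intro measure_measure_pmf_finite) auto
  also have "\<dots> = (\<Sum>a\<in>set_pmf p. if a \<in> A then pmf p a else 0)"
    using assms by (simp add: sum.inter_restrict[symmetric] Int_commute)
  finally show ?thesis .
qed

lemma cell_eq_sum:
  assumes "finite (set_pmf p)"
  shows "cell p X a = (\<Sum>b\<in>set_pmf p. if X b = X a then pmf p b else 0)"
  unfolding cell_def by (subst prob_eq_sum[OF assms]) simp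

lemma cell_pos:
  assumes "a \<in> set_pmf p"
  shows "0 < cell p X a"
proof -
  have "0 < pmf p a" using assms by (simp add: pmf_positive)
  also have "pmf p a \<le> cell p X a"
    unfolding cell_def by (subst measure_pmf_single[symmetric]) (rule measure_pmf.finite_measure_mono, auto)
  finally show ?thesis .
qed

lemma cell_nonneg: "0 \<le> cell p X a"
  by (simp add: cell_def)

lemma cell_mono:
  assumes "\<And>b. b \<in> set_pmf p \<Longrightarrow> X b = X a \<Longrightarrow> Y b = Y a"
  shows "cell p X a \<le> cell p Y a"
proof -
  have "cell p X a = measure_pmf.prob p ({b. X b = X a} \<inter> set_pmf p)"
    by (simp add: cell_def measure_Int_set_pmf)
  also have "\<dots> \<le> cell p Y a"
    unfolding cell_def using assms by (intro measure_pmf.finite_measure_mono) auto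
  finally show ?thesis .
qed

lemma cell_cong: "X a = X b \<Longrightarrow> cell p X a = cell p X b"
  by (simp add: cell_def)

lemma cell_eqI: "(\<And>b. X b = X a \<longleftrightarrow> Y b = Y a) \<Longrightarrow> cell p X a = cell p Y a"
  by (simp add: cell_def)

lemma cell_eq_pmf_map: "cell p X a = pmf (map_pmf X p) (X a)"
  by (auto simp: cell_def pmf_map vimage_def)

lemma sum_set_pmf_eq_expectation:
  fixes g :: "'a \<Rightarrow> real"
  assumes "finite (set_pmf p)"
  shows "(\<Sum>a\<in>set_pmf p. pmf p a * g a) = measure_pmf.expectation p g"
  using assms by (subst integral_measure_pmf_real[of "set_pmf p"]) (auto simp: mult.commute)

lemma ent_mono:
  assumes "\<And>a b. a \<in> set_pmf p \<Longrightarrow> b \<in> set_pmf p \<Longrightarrow> X a = X b \<Longrightarrow> Y a = Y b"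
  shows "ent p Y \<le> ent p X"
  unfolding ent_def
proof (rule sum_mono)
  fix a assume a: "a \<in> set_pmf p"
  have "cell p X a \<le> cell p Y a" using a by (intro cell_mono assms)
  then have "- log 2 (cell p Y a) \<le> - log 2 (cell p X a)"
    using cell_pos[OF a, of X] by (simp add: log_mono)
  then show "pmf p a * - log 2 (cell p Y a) \<le> pmf p a * - log 2 (cell p X a)"
    by (rule mult_left_mono) (rule pmf_nonneg)
qed

text \<open>Only the induced partition of the support matters. Every regrouping, reordering or
  injective recoding of variables below is justified this way.\<close>

lemma ent_cong:
  assumes "\<And>a b. a \<in> set_pmf p \<Longrightarrow> b \<in> set_pmf p \<Longrightarrow> X a = X b \<longleftrightarrow> Y a = Y b"
  shows "ent p X = ent p Y"
  by (intro antisym ent_mono) (use assms in blast)+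

lemma ent_map:
  assumes "finite (set_pmf p)"
  shows "ent (map_pmf f p) X = ent p (\<lambda>a. X (f a))"
proof -
  have "cell (map_pmf f p) X (f a) = cell p (\<lambda>a. X (f a)) a" for a
    by (simp add: cell_eq_pmf_map map_pmf_comp)
  moreover have "ent (map_pmf f p) X = measure_pmf.expectation (map_pmf f p) (\<lambda>a.
    - log 2 (cell (map_pmf f p) X a))"
    unfolding ent_def using assms by (intro sum_set_pmf_eq_expectation) simp
  moreover have "ent p (\<lambda>a. X (f a)) = measure_pmf.expectation p (\<lambda>a.
    - log 2 (cell p (\<lambda>a. X (f a)) a))"
    unfolding ent_def using assms by (rule sum_set_pmf_eq_expectation)
  ultimately show ?thesis by simp
qed

lemma ent_const: "(\<And>a. a \<in> set_pmf p \<Longrightarrow> X a = c) \<Longrightarrow> ent p X = 0"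
proof -
  assume X: "\<And>a. a \<in> set_pmf p \<Longrightarrow> X a = c"
  have "cell p X a = 1" if "a \<in> set_pmf p" for a
    unfolding cell_def using X that
      by (intro measure_pmf.prob_eq_1[THEN iffD2]) (auto simp: AE_measure_pmf_iff)
  then show ?thesis by (simp add: ent_def)
qed

section \<open>Gibbs-type inequalities restricted to a union of cells\<close>

lemma log2_ge:
  assumes "0 < t" shows "log 2 t \<ge> (1 - 1 / t) / ln 2"
proof -
  have "ln (1 / t) \<le> 1 / t - 1" using assms by (intro ln_le_minus_one) auto
  then have "ln t \<ge> 1 - 1 / t" using assms by (simp add: ln_div)
  then show ?thesis by (simp add: log_def divide_right_mono)
qed

text \<open>Since \<open>X\<close> is constant on \<open>K\<close>, the denominators are one common
  cell probability, and that cell contains \<open>K\<close>.\<close>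

lemma sum_over_cell_le_1:
  assumes fin: "finite (set_pmf p)" and "K \<subseteq> set_pmf p"
    and "\<And>a b. a \<in> K \<Longrightarrow> b \<in> K \<Longrightarrow> X a = X b"
  shows "(\<Sum>a\<in>K. pmf p a / cell p X a) \<le> 1"
proof (cases "K = {}")
  case False
  then obtain a where a: "a \<in> K" by blast
  have "(\<Sum>b\<in>K. pmf p b / cell p X b) = (\<Sum>b\<in>K. pmf p b / cell p X a)"
    by (intro sum.cong refl arg_cong2[where f="(/)"] cell_cong assms(3) a)
  also have "\<dots> = measure_pmf.prob p K / cell p X a"
    using finite_subset[OF assms(2) fin] by (simp add: sum_divide_distrib measure_measure_pmf_finite)
  also have "\<dots> \<le> 1"
  proof -
    have "measure_pmf.prob p K \<le> cell p X a"
      unfolding cell_def by (intro measure_pmf.finite_measure_mono subsetI CollectI assms(3) a) auto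
    then show ?thesis using cell_pos[of a p X] a assms(2) by auto
  qed
  finally show ?thesis .
qed auto

text \<open>Nonnegativity of conditional mutual information, localized to a union \<open>D\<close>
  of cells of \<open>Z\<close>. By \<open>log2_ge\<close> it suffices that the
  \<open>p\<close>-weighted sum of \<open>cx * cy / (c * cz)\<close> over \<open>D\<close> is at
  most the mass of \<open>D\<close>. The local form serves \<open>cmi_continuity\<close>, where
  \<open>D\<close> is the part on which two laws differ.\<close>

lemma cmi_part_nonneg:
  assumes fin: "finite (set_pmf p)"
    and D: "D \<subseteq> set_pmf p" "\<And>a b. a \<in> D \<Longrightarrow> b \<in> set_pmf p \<Longrightarrow> Z a = Z b \<Longrightarrow> b \<in> D"
  shows "0 \<le> (\<Sum>a\<in>D. pmf p a * (log 2 (cell p (\<lambda>a. (X a, Y a, Z a)) a) + log 2 (cell p Z a)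
     - log 2 (cell p (\<lambda>a. (X a, Z a)) a) - log 2 (cell p (\<lambda>a. (Y a, Z a)) a)))"
    (is "0 \<le> (\<Sum>a\<in>D. pmf p a * ?L a)")
proof -
  define c where "c = cell p (\<lambda>a. (X a, Y a, Z a))"
  define cz where "cz = cell p Z"
  define cx where "cx = cell p (\<lambda>a. (X a, Z a))"
  define cy where "cy = cell p (\<lambda>a. (Y a, Z a))"
  note defs = c_def cz_def cx_def cy_def
  let ?S = "set_pmf p"
  have finD: "finite D" using D(1) fin by (rule finite_subset)
  have pos: "0 < c a" "0 < cz a" "0 < cx a" "0 < cy a" if "a \<in> ?S" for a
    using that by (auto simp: defs cell_pos)
  have term_ge: "pmf p a * ?L a \<ge> (pmf p a - pmf p a * (cx a * cy a / (c a * cz a))) / ln 2"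
    if "a \<in> D" for a
  proof -
    have a: "a \<in> ?S" using that D by auto
    note P = pos[OF a]
    have "?L a = log 2 (c a * cz a / (cx a * cy a))"
      using P by (simp add: defs[symmetric] log_mult log_divide)
    moreover have "log 2 (c a * cz a / (cx a * cy a)) \<ge> (1 - 1 / (c a * cz a / (cx a * cy a))) / ln 2"
      using P by (intro log2_ge) auto
    ultimately have "?L a \<ge> (1 - cx a * cy a / (c a * cz a)) / ln 2" by simp
    then have "pmf p a * ?L a \<ge> pmf p a * ((1 - cx a * cy a / (c a * cz a)) / ln 2)"
      by (intro mult_left_mono) auto
    then show ?thesis by (simp add: algebra_simps)
  qed
  \<comment> \<open>Writing \<open>cx\<close> and \<open>cy\<close> as sums over points
    \<open>b\<close> and \<open>e\<close> leaves, for each pair, the points of \<open>D\<close> that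
    share \<open>X\<close> with \<open>b\<close>, \<open>Y\<close> with \<open>e\<close> and
    \<open>Z\<close> with both.\<close>
  define K where "K b e = {a\<in>D. X a = X b \<and> Z a = Z b \<and> Y a = Y e \<and> Z a = Z e}" for b e
  have inner: "(\<Sum>a\<in>K b e. pmf p a / (c a * cz a)) \<le> (if b \<in> D \<and> Z e = Z b then 1 / cz b else 0)"
    if b: "b \<in> ?S" for b e
  proof (cases "K b e = {}")
    case True
    then show ?thesis using pos[OF b] by auto
  next
    case False
    then obtain a where a: "a \<in> D" "X a = X b" "Z a = Z b" "Y a = Y e" "Z a = Z e" by (auto simp: K_def)
    have bD: "b \<in> D" "Z e = Z b" using D(2)[OF a(1) b] a by auto
    have "(\<Sum>a\<in>K b e. pmf p a / (c a * cz a)) = (\<Sum>a\<in>K b e. pmf p a / c a / cz b)"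
    proof (intro sum.cong refl)
      fix a' assume "a' \<in> K b e"
      then have "cz a' = cz b" unfolding cz_def by (intro cell_cong) (auto simp: K_def)
      then show "pmf p a' / (c a' * cz a') = pmf p a' / c a' / cz b" by simp
    qed
    also have "\<dots> = (\<Sum>a\<in>K b e. pmf p a / c a) / cz b" by (simp add: sum_divide_distrib)
    also have "\<dots> \<le> 1 / cz b"
      using pos(2)[OF b] unfolding c_def using D(1)
      by (intro divide_right_mono sum_over_cell_le_1 fin) (auto simp: K_def)
    finally show ?thesis using bD by simp
  qed
  have "(\<Sum>a\<in>D. pmf p a * (cx a * cy a / (c a * cz a)))
      = (\<Sum>a\<in>D. \<Sum>b\<in>?S. \<Sum>e\<in>?S. pmf p b * pmf p e * (if a \<in> K b e then pmf p a / (c a * cz a) else 0))"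
  proof (intro sum.cong refl)
    fix a assume a: "a \<in> D"
    have "pmf p a * (cx a * cy a / (c a * cz a)) = cx a * cy a * (pmf p a / (c a * cz a))" by simp
    also have "\<dots> = (\<Sum>b\<in>?S. \<Sum>e\<in>?S. (if (X b, Z b)
      = (X a, Z a) then pmf p b else 0) * (if (Y e, Z e)
        = (Y a, Z a) then pmf p e else 0) * (pmf p a / (c a * cz a)))"
      unfolding cx_def cy_def cell_eq_sum[OF fin] sum_product by (simp only: sum_distrib_right)
    also have "\<dots> = (\<Sum>b\<in>?S. \<Sum>e\<in>?S. pmf p b * pmf p e * (if a \<in> K b e then pmf p a / (c a * cz a)
      else 0))"
      using a by (intro sum.cong refl) (auto simp: K_def)
    finally show "pmf p a * (cx a * cy a / (c a * cz a)) = \<dots>" .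
  qed
  also have "\<dots> = (\<Sum>b\<in>?S. \<Sum>e\<in>?S. \<Sum>a\<in>D. pmf p b * pmf p e * (if a \<in> K b e then pmf p a / (c a * cz a)
    else 0))"
    by (subst sum.swap) (intro sum.cong refl sum.swap)
  also have "\<dots> = (\<Sum>b\<in>?S. \<Sum>e\<in>?S. pmf p b * pmf p e * (\<Sum>a\<in>K b e. pmf p a / (c a * cz a)))"
  proof (intro sum.cong refl)
    fix b e
    have "D \<inter> K b e = K b e" by (auto simp: K_def)
    then show "(\<Sum>a\<in>D. pmf p b * pmf p e * (if a \<in> K b e then pmf p a / (c a * cz a) else 0))
      = pmf p b * pmf p e * (\<Sum>a\<in>K b e. pmf p a / (c a * cz a))"
      by (simp add: sum_distrib_left[symmetric] sum.inter_restrict[OF finD, symmetric])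
  qed
  \<comment> \<open>After this bound the sum over \<open>e\<close> collects exactly
    \<open>cz b\<close>, which cancels the denominator.\<close>
  also have "\<dots> \<le> (\<Sum>b\<in>?S. \<Sum>e\<in>?S. pmf p b * pmf p e * (if b \<in> D \<and> Z e = Z b then 1 / cz b else 0))"
    by (intro sum_mono mult_left_mono inner) auto
  also have "\<dots> = (\<Sum>b\<in>?S. if b \<in> D then pmf p b else 0)"
  proof (intro sum.cong refl)
    fix b assume b: "b \<in> ?S"
    have "(\<Sum>e\<in>?S. pmf p b * pmf p e * (if b \<in> D \<and> Z e = Z b then 1 / cz b else 0))
      = (if b \<in> D then pmf p b / cz b * (\<Sum>e\<in>?S. if Z e = Z b then pmf p e else 0) else 0)"
      by (auto simp: sum_distrib_left intro!: sum.cong)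
    also have "\<dots> = (if b \<in> D then pmf p b else 0)"
      unfolding cell_eq_sum[OF fin, symmetric] cz_def[symmetric] using pos(2)[OF b] by simp
    finally show "(\<Sum>e\<in>?S. pmf p b * pmf p e * (if b \<in> D \<and> Z e = Z b then 1 / cz b else 0)) = \<dots>" .
  qed
  also have "\<dots> = (\<Sum>b\<in>D. pmf p b)"
    using fin D(1) by (simp add: sum.inter_restrict[symmetric] Int_absorb1)
  finally have main: "(\<Sum>a\<in>D. pmf p a * (cx a * cy a / (c a * cz a))) \<le> (\<Sum>b\<in>D. pmf p b)" .
  have "0 \<le> ((\<Sum>a\<in>D. pmf p a) - (\<Sum>a\<in>D. pmf p a * (cx a * cy a / (c a * cz a)))) / ln 2"
    using main by simp
  also have "\<dots> = (\<Sum>a\<in>D. (pmf p a - pmf p a * (cx a * cy a / (c a * cz a))) / ln 2)"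
    by (simp add: sum_subtractf sum_divide_distrib diff_divide_distrib)
  also have "\<dots> \<le> (\<Sum>a\<in>D. pmf p a * ?L a)" by (intro sum_mono term_ge)
  finally show ?thesis .
qed

text \<open>The contribution of \<open>D\<close> to the entropy of \<open>X\<close> given
  \<open>Z\<close>, compared with the uniform law on \<open>K\<close>: apply \<open>log2_ge\<close>
  to \<open>M * c / cz\<close>. Used on the error event in \<open>fano\<close> and on the differing
  part of two laws in \<open>cmi_continuity\<close>.\<close>

lemma cond_ent_part_le:
  assumes fin: "finite (set_pmf p)"
    and D: "D \<subseteq> set_pmf p" "\<And>a b. a \<in> D \<Longrightarrow> b \<in> set_pmf p \<Longrightarrow> Z a = Z b \<Longrightarrow> b \<in> D"
    and K: "finite K" "\<And>a. a \<in> D \<Longrightarrow> X a \<in> K"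
  shows "(\<Sum>a\<in>D. pmf p a * (log 2 (cell p Z a) - log 2 (cell p (\<lambda>a. (X a, Z a)) a)))
      \<le> measure_pmf.prob p D * log 2 (card K)"
proof (cases "D = {}")
  case False
  define c where "c = cell p (\<lambda>a. (X a, Z a))"
  define cz where "cz = cell p Z"
  define M where "M = real (card K)"
  let ?S = "set_pmf p"
  have finD: "finite D" using D(1) fin by (rule finite_subset)
  have M: "M > 0" using False K by (auto simp: M_def card_gt_0_iff)
  have pos: "0 < c a" "0 < cz a" if "a \<in> D" for a
    using that D(1) by (auto simp: c_def cz_def intro!: cell_pos)
  have term_le: "pmf p a * (log 2 (cz a) - log 2 (c a)) \<le> pmf p a * log 2 M
    + (pmf p a * (cz a / c a) / M - pmf p a) / ln 2"
    if a: "a \<in> D" for a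
  proof -
    note P = pos[OF a]
    have "log 2 (M * c a / cz a) \<ge> (1 - 1 / (M * c a / cz a)) / ln 2"
      using P M by (intro log2_ge) auto
    then have "log 2 (cz a) - log 2 (c a) \<le> log 2 M + (cz a / c a / M - 1) / ln 2"
      using P M by (simp add: log_mult log_divide field_simps)
    then have "pmf p a * (log 2 (cz a) - log 2 (c a)) \<le> pmf p a * (log 2 M + (cz a / c a / M - 1) / ln 2)"
      by (intro mult_left_mono) auto
    then show ?thesis by (simp add: algebra_simps diff_divide_distrib)
  qed
  have "(\<Sum>a\<in>D. pmf p a * (cz a / c a)) = (\<Sum>a\<in>D. \<Sum>b\<in>?S. if Z b
    = Z a then pmf p b * (pmf p a / c a) else 0)"
    unfolding cz_def cell_eq_sum[OF fin]
    by (auto simp: sum_distrib_left sum_divide_distrib sum_distrib_right intro!: sum.cong)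
  also have "\<dots> = (\<Sum>a\<in>D. \<Sum>b\<in>D. if Z b = Z a then pmf p b * (pmf p a / c a) else 0)"
    using D fin by (intro sum.cong refl sum.mono_neutral_right) auto
  also have "\<dots> = (\<Sum>b\<in>D. pmf p b * (\<Sum>a\<in>D. if Z b = Z a then pmf p a / c a else 0))"
    by (subst sum.swap) (auto simp: sum_distrib_left intro!: sum.cong)
  also have "\<dots> \<le> (\<Sum>b\<in>D. pmf p b * M)"
  \<comment> \<open>Within one cell of \<open>Z\<close> the points are sorted by their value of
    \<open>X\<close>; each of the at most \<open>M\<close> values contributes at most 1.\<close>
  proof (intro sum_mono mult_left_mono)
    fix b assume b: "b \<in> D"
    have "(\<Sum>a\<in>D. if Z b = Z a then pmf p a / c a else 0) = (\<Sum>a\<in>D. \<Sum>x\<in>K. if Z b = Z a \<and> X a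
      = x then pmf p a / c a else 0)"
      using K by (intro sum.cong refl) auto
    also have "\<dots> = (\<Sum>x\<in>K. \<Sum>a\<in>D. if Z b = Z a \<and> X a = x then pmf p a / c a else 0)"
      by (rule sum.swap)
    also have "\<dots> = (\<Sum>x\<in>K. \<Sum>a\<in>{a\<in>D. Z b = Z a \<and> X a = x}. pmf p a / c a)"
      by (rule sum.cong[OF refl]) (rule sum.inter_filter[OF finD, symmetric])
    also have "\<dots> \<le> (\<Sum>x\<in>K. 1)"
      unfolding c_def using D(1) by (intro sum_mono sum_over_cell_le_1 fin) auto
    finally show "(\<Sum>a\<in>D. if Z b = Z a then pmf p a / c a else 0) \<le> M" by (simp add: M_def)
  qed auto
  finally have main: "(\<Sum>a\<in>D. pmf p a * (cz a / c a)) / M \<le> (\<Sum>a\<in>D. pmf p a)"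
    using M by (simp add: sum_distrib_left field_simps)
  have "(\<Sum>a\<in>D. pmf p a * (log 2 (cz a) - log 2 (c a)))
     \<le> (\<Sum>a\<in>D. pmf p a * log 2 M + (pmf p a * (cz a / c a) / M - pmf p a) / ln 2)"
    by (intro sum_mono term_le)
  also have "\<dots> = (\<Sum>a\<in>D. pmf p a) * log 2 M + ((\<Sum>a\<in>D. pmf p a * (cz a / c a)) / M
    - (\<Sum>a\<in>D. pmf p a)) / ln 2"
    by (simp add: sum.distrib sum_subtractf sum_divide_distrib diff_divide_distrib sum_distrib_right)
  also have "\<dots> \<le> (\<Sum>a\<in>D. pmf p a) * log 2 M" using main by (simp add: divide_nonpos_pos)
  also have "(\<Sum>a\<in>D. pmf p a) = measure_pmf.prob p D"
    using finD by (simp add: measure_measure_pmf_finite)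
  finally show ?thesis by (simp add: c_def cz_def M_def)
qed simp

lemma cmi_eq_sum:
  "cmi p X Y Z = (\<Sum>a\<in>set_pmf p. pmf p a * (log 2 (cell p (\<lambda>a. (X a, Y a, Z a)) a)
    + log 2 (cell p Z a)
     - log 2 (cell p (\<lambda>a. (X a, Z a)) a) - log 2 (cell p (\<lambda>a. (Y a, Z a)) a)))"
  unfolding cmi_def ent_def
  by (simp add: sum_negf sum.distrib sum_subtractf distrib_left right_diff_distrib)

lemma cmi_nonneg: "finite (set_pmf p) \<Longrightarrow> 0 \<le> cmi p X Y Z"
  unfolding cmi_eq_sum by (rule cmi_part_nonneg) auto

lemma mi_nonneg:
  assumes "finite (set_pmf p)" shows "0 \<le> mi p X Y"
proof -
  have "cmi p X Y (\<lambda>_. ()) = mi p X Y"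
  proof -
    have "ent p (\<lambda>a. (X a, ())) = ent p X" "ent p (\<lambda>a. (Y a, ())) = ent p Y"
      "ent p (\<lambda>a. (X a, Y a, ())) = ent p (\<lambda>a. (X a, Y a))" "ent p (\<lambda>_. ()) = 0"
      by (auto intro!: ent_cong ent_const)
    then show ?thesis by (simp add: cmi_def mi_def)
  qed
  with cmi_nonneg[OF assms, of X Y "\<lambda>_. ()"] show ?thesis by simp
qed

lemma ent_le_log_card:
  assumes fin: "finite (set_pmf p)" and K: "finite K" "\<And>a. a \<in> set_pmf p \<Longrightarrow> X a \<in> K"
  shows "ent p X \<le> log 2 (card K)"
proof -
  have "(\<Sum>a\<in>set_pmf p. pmf p a * (log 2 (cell p (\<lambda>_. ()) a) - log 2 (cell p (\<lambda>a. (X a, ())) a)))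
      \<le> measure_pmf.prob p (set_pmf p) * log 2 (card K)"
    using K by (intro cond_ent_part_le fin) auto
  moreover have "measure_pmf.prob p (set_pmf p) = 1"
    by (simp add: measure_pmf.prob_eq_1 AE_measure_pmf_iff)
  moreover have "cell p (\<lambda>_. ()) a = 1" "cell p (\<lambda>a. (X a, ())) a = cell p X a" for a
    by (simp_all add: cell_def)
  ultimately show ?thesis by (simp add: ent_def)
qed

section \<open>Chain rule, data processing and the effect of revealing one bit\<close>

lemma cmi_map:
  assumes "finite (set_pmf p)"
  shows "cmi (map_pmf f p) X Y Z = cmi p (\<lambda>a. X (f a)) (\<lambda>a. Y (f a)) (\<lambda>a. Z (f a))"
  unfolding cmi_def by (simp add: ent_map[OF assms])

lemma cmi_cong:
  assumes "\<And>a b. a \<in> set_pmf p \<Longrightarrow> b \<in> set_pmf p \<Longrightarrow> X a = X b \<longleftrightarrow> X' a = X' b"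
    and "\<And>a b. a \<in> set_pmf p \<Longrightarrow> b \<in> set_pmf p \<Longrightarrow> Y a = Y b \<longleftrightarrow> Y' a = Y' b"
    and "\<And>a b. a \<in> set_pmf p \<Longrightarrow> b \<in> set_pmf p \<Longrightarrow> Z a = Z b \<longleftrightarrow> Z' a = Z' b"
  shows "cmi p X Y Z = cmi p X' Y' Z'"
proof -
  have "ent p (\<lambda>a. (X a, Z a)) = ent p (\<lambda>a. (X' a, Z' a))"
    "ent p (\<lambda>a. (Y a, Z a)) = ent p (\<lambda>a. (Y' a, Z' a))"
    "ent p (\<lambda>a. (X a, Y a, Z a)) = ent p (\<lambda>a. (X' a, Y' a, Z' a))" "ent p Z = ent p Z'"
    by (intro ent_cong; simp add: assms)+
  then show ?thesis by (simp add: cmi_def)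
qed

lemma cmi_chain:
  "cmi p X (\<lambda>a. (A a, B a)) U = cmi p X A U + cmi p X B (\<lambda>a. (U a, A a))"
proof -
  have "ent p (\<lambda>a. ((A a, B a), U a)) = ent p (\<lambda>a. (B a, U a, A a))"
    "ent p (\<lambda>a. (X a, (A a, B a), U a)) = ent p (\<lambda>a. (X a, B a, U a, A a))"
    "ent p (\<lambda>a. (A a, U a)) = ent p (\<lambda>a. (U a, A a))"
    "ent p (\<lambda>a. (X a, A a, U a)) = ent p (\<lambda>a. (X a, U a, A a))"
    by (intro ent_cong; auto)+
  then show ?thesis by (simp add: cmi_def)
qed

lemma cmi_commute: "cmi p X Y Z = cmi p Y X Z"
proof -
  have "ent p (\<lambda>a. (X a, Y a, Z a)) = ent p (\<lambda>a. (Y a, X a, Z a))"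
    by (intro ent_cong) auto
  then show ?thesis by (simp add: cmi_def)
qed

text \<open>As \<open>A\<close> and \<open>Z\<close> determine \<open>m\<close>, the right side
  exceeds the left by exactly \<open>cmi p B m Z\<close>.\<close>

lemma cmi_message_le:
  assumes fin: "finite (set_pmf p)"
    and m: "\<And>a b. A a = A b \<Longrightarrow> Z a = Z b \<Longrightarrow> m a = m b"
  shows "cmi p A B (\<lambda>a. (Z a, m a)) \<le> cmi p A B Z"
proof -
  have "ent p (\<lambda>a. (A a, Z a, m a)) = ent p (\<lambda>a. (A a, Z a))"
    "ent p (\<lambda>a. (A a, B a, Z a, m a)) = ent p (\<lambda>a. (A a, B a, Z a))"
    "ent p (\<lambda>a. (B a, m a, Z a)) = ent p (\<lambda>a. (B a, Z a, m a))"
    "ent p (\<lambda>a. (m a, Z a)) = ent p (\<lambda>a. (Z a, m a))"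
    by (intro ent_cong; auto intro: m)+
  then show ?thesis
    using cmi_nonneg[OF fin, of B m Z] by (simp add: cmi_def)
qed

text \<open>As \<open>X\<close> and \<open>Z\<close> determine \<open>X'\<close>, the gap is exactly
  \<open>cmi p X Y\<close> conditioned on \<open>Z\<close> and \<open>X'\<close>.\<close>

lemma cmi_data_processing:
  assumes fin: "finite (set_pmf p)"
    and X: "\<And>a b. X a = X b \<Longrightarrow> Z a = Z b \<Longrightarrow> X' a = X' b"
  shows "cmi p X' Y Z \<le> cmi p X Y Z"
proof -
  have "ent p (\<lambda>a. (X a, Z a, X' a)) = ent p (\<lambda>a. (X a, Z a))"
    "ent p (\<lambda>a. (X a, Y a, Z a, X' a)) = ent p (\<lambda>a. (X a, Y a, Z a))"
    "ent p (\<lambda>a. (Y a, Z a, X' a)) = ent p (\<lambda>a. (X' a, Y a, Z a))"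
    "ent p (\<lambda>a. (Z a, X' a)) = ent p (\<lambda>a. (X' a, Z a))"
    by (intro ent_cong; auto intro: X)+
  then show ?thesis
    using cmi_nonneg[OF fin, of X Y "\<lambda>a. (Z a, X' a)"] by (simp add: cmi_def)
qed

lemma cmi_bit_le_1:
  fixes B :: "'a \<Rightarrow> bool"
  assumes fin: "finite (set_pmf p)"
  shows "cmi p X B Z \<le> 1"
proof -
  have "ent p B \<le> log 2 (card (UNIV :: bool set))" by (rule ent_le_log_card[OF fin]) auto
  moreover have "0 \<le> mi p B Z" by (rule mi_nonneg[OF fin])
  moreover have "ent p (\<lambda>a. (X a, Z a)) \<le> ent p (\<lambda>a. (X a, B a, Z a))" by (rule ent_mono) auto
  ultimately show ?thesis by (simp add: mi_def cmi_def)
qed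

text \<open>The information between \<open>X\<close> and the pair of \<open>B\<close> and
  \<open>Y\<close> is expanded by the chain rule in both orders; the two terms that involve the bit
  lie between 0 and 1.\<close>

lemma cmi_condition_bit:
  fixes B :: "'a \<Rightarrow> bool"
  assumes fin: "finite (set_pmf p)"
  shows "cmi p X Y Z \<le> cmi p X Y (\<lambda>a. (Z a, B a)) + 1"
    and "cmi p X Y (\<lambda>a. (Z a, B a)) \<le> cmi p X Y Z + 1"
proof -
  have 1: "cmi p X (\<lambda>a. (B a, Y a)) Z = cmi p X B Z + cmi p X Y (\<lambda>a. (Z a, B a))"
    by (rule cmi_chain)
  have 2: "cmi p X (\<lambda>a. (Y a, B a)) Z = cmi p X Y Z + cmi p X B (\<lambda>a. (Z a, Y a))"
    by (rule cmi_chain)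
  have 3: "cmi p X (\<lambda>a. (Y a, B a)) Z = cmi p X (\<lambda>a. (B a, Y a)) Z" by (intro cmi_cong) auto
  note nn = cmi_nonneg[OF fin, of X B Z] cmi_nonneg[OF fin, of X B "\<lambda>a. (Z a, Y a)"]
  note le = cmi_bit_le_1[OF fin, of X B Z] cmi_bit_le_1[OF fin, of X B "\<lambda>a. (Z a, Y a)"]
  show "cmi p X Y Z \<le> cmi p X Y (\<lambda>a. (Z a, B a)) + 1" using 1 2 3 nn le by linarith
  show "cmi p X Y (\<lambda>a. (Z a, B a)) \<le> cmi p X Y Z + 1" using 1 2 3 nn le by linarith
qed

text \<open>Revealing whether \<open>X = Y\<close> costs at most one bit. Given that indicator and
  \<open>Y\<close>, uncertainty about \<open>X\<close> remains only on the error event.\<close>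

lemma fano:
  assumes fin: "finite (set_pmf p)" and K: "finite K" "\<And>a. a \<in> set_pmf p \<Longrightarrow> X a \<in> K"
  shows "ent p (\<lambda>a. (X a, Y a)) - ent p Y \<le> 1 + measure_pmf.prob p {a. X a \<noteq> Y a} * log 2 (card K)"
proof -
  define Z where "Z = (\<lambda>a. (Y a, X a = Y a))"
  define D where "D = {a\<in>set_pmf p. X a \<noteq> Y a}"
  let ?t = "\<lambda>a. pmf p a * (log 2 (cell p Z a) - log 2 (cell p (\<lambda>a. (X a, Z a)) a))"
  have "ent p (\<lambda>a. (X a, Z a)) - ent p Z = (\<Sum>a\<in>set_pmf p. ?t a)"
    by (simp add: ent_def sum_negf sum_subtractf right_diff_distrib)
  also have "\<dots> = (\<Sum>a\<in>D. ?t a)"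
  proof (rule sum.mono_neutral_right[OF fin])
    show "\<forall>a\<in>set_pmf p - D. ?t a = 0"
    proof
      fix a assume "a \<in> set_pmf p - D"
      then have "X a = Y a" by (simp add: D_def)
      then have "{b. (X b, Z b) = (X a, Z a)} = {b. Z b = Z a}" by (auto simp: Z_def)
      then show "?t a = 0" by (simp add: cell_def)
    qed
  qed (simp add: D_def)
  also have "\<dots> \<le> measure_pmf.prob p D * log 2 (card K)"
    by (rule cond_ent_part_le[OF fin]) (auto simp: D_def Z_def K)
  also have "measure_pmf.prob p D = measure_pmf.prob p {a. X a \<noteq> Y a}"
    by (subst (2) measure_Int_set_pmf[symmetric]) (auto simp: D_def intro!: arg_cong2[where f=measure])
  finally have 1: "ent p (\<lambda>a. (X a, Z a)) - ent p Z
    \<le> measure_pmf.prob p {a. X a \<noteq> Y a} * log 2 (card K)" .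
  have "ent p (\<lambda>a. (X a, Z a)) = ent p (\<lambda>a. (X a, Y a))" by (intro ent_cong) (auto simp: Z_def)
  moreover have "ent p Z \<le> ent p Y + 1"
  proof -
    have "ent p (\<lambda>a. X a = Y a) \<le> log 2 (card (UNIV :: bool set))"
      by (rule ent_le_log_card[OF fin]) auto
    moreover have "0 \<le> mi p Y (\<lambda>a. X a = Y a)" by (rule mi_nonneg[OF fin])
    ultimately show ?thesis by (simp add: mi_def Z_def)
  qed
  ultimately show ?thesis using 1 by simp
qed

section \<open>Comparison with the measure-theoretic quantities\<close>

lemma pair_count_space_UNIV:
  "count_space (UNIV :: 'a::countable set) \<Otimes>\<^sub>M count_space (UNIV :: 'b::countable set)
    = count_space UNIV"
  by (subst pair_measure_countable) auto

lemma sigma_finite_count_space_UNIV: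
  "sigma_finite_measure (count_space (UNIV :: 'a::countable set))"
  by (rule sigma_finite_measure_count_space_countable) auto

lemma information_space_measure_pmf: "information_space (measure_pmf p) 2"
  by (intro information_space.intro information_space_axioms.intro measure_pmf.prob_space_axioms) simp

lemma distributed_measure_pmf:
  "distributed (measure_pmf p) (count_space UNIV) X (\<lambda>x. ennreal (pmf (map_pmf X p) x))"
proof -
  have "distr (measure_pmf p) (count_space UNIV) X = measure_pmf (map_pmf X p)"
    by (simp add: map_pmf_rep_eq)
  then show ?thesis
    by (simp add: distributed_def measure_pmf_eq_density[symmetric])
qed

lemma integral_count_space_pmf:
  fixes g :: "'b \<Rightarrow> real"
  assumes "finite (set_pmf p)"
  shows "(\<integral>x. pmf (map_pmf X p) x * g x \<partial>count_space UNIV) = (\<Sum>a\<in>set_pmf p. pmf p a * g (X a))"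
proof -
  have "(\<integral>x. pmf (map_pmf X p) x * g x \<partial>count_space UNIV) = measure_pmf.expectation (map_pmf X p) g"
    by (subst measure_pmf_eq_density) (simp add: integral_density)
  also have "\<dots> = (\<Sum>a\<in>set_pmf p. pmf p a * g (X a))"
    using assms by (simp add: sum_set_pmf_eq_expectation)
  finally show ?thesis .
qed

lemma entropy2_eq_ent:
  fixes X :: "'a \<Rightarrow> 'b::countable"
  assumes "finite (set_pmf p)"
  shows "entropy2 p X = ent p X"
proof -
  interpret information_space "measure_pmf p" 2 by (rule information_space_measure_pmf)
  have "entropy2 p X = - (\<integral>x. pmf (map_pmf X p) x * log 2 (pmf (map_pmf X p) x) \<partial>count_space UNIV)"
    by (intro entropy_distr distributed_measure_pmf) simp
  also have "\<dots> = ent p X"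
    by (simp add: integral_count_space_pmf assms ent_def cell_eq_pmf_map sum_negf)
  finally show ?thesis .
qed

lemma mutual_info2_eq_mi:
  fixes X :: "'a \<Rightarrow> 'b::countable" and Y :: "'a \<Rightarrow> 'c::countable"
  assumes "finite (set_pmf p)"
  shows "mutual_info2 p X Y = mi p X Y"
proof -
  interpret information_space "measure_pmf p" 2 by (rule information_space_measure_pmf)
  let ?XY = "\<lambda>a. (X a, Y a)"
  have "mutual_info2 p X Y = (\<integral>x. pmf (map_pmf ?XY p) x *
      log 2 (pmf (map_pmf ?XY p) x / (pmf (map_pmf X p) (fst x) * pmf (map_pmf Y p) (snd x)))
      \<partial>(count_space UNIV \<Otimes>\<^sub>M count_space UNIV))"
    by (intro mutual_information_distr sigma_finite_count_space_UNIV distributed_measure_pmf)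
      (simp_all add: pair_count_space_UNIV distributed_measure_pmf)
  also have "\<dots> = (\<Sum>a\<in>set_pmf p. pmf p a * log 2 (cell p ?XY a / (cell p X a * cell p Y a)))"
    by (simp add: pair_count_space_UNIV integral_count_space_pmf assms cell_eq_pmf_map)
  also have "\<dots> = (\<Sum>a\<in>set_pmf p. pmf p a * (log 2 (cell p ?XY a) - log 2 (cell p X a)
    - log 2 (cell p Y a)))"
  proof (intro sum.cong refl)
    fix a assume a: "a \<in> set_pmf p"
    show "pmf p a * log 2 (cell p ?XY a / (cell p X a * cell p Y a))
      = pmf p a * (log 2 (cell p ?XY a) - log 2 (cell p X a) - log 2 (cell p Y a))"
      using cell_pos[OF a, of ?XY] cell_pos[OF a, of X] cell_pos[OF a, of Y]
      by (simp add: log_mult log_divide)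
  qed
  also have "\<dots> = mi p X Y"
    by (simp add: mi_def ent_def sum_negf right_diff_distrib sum_subtractf)
  finally show ?thesis .
qed

text \<open>The measure-theoretic definition is the difference of the information of
  \<open>X\<close> about \<open>(Y, Z)\<close> and about \<open>Z\<close>, so the unconditional
  comparison suffices.\<close>

lemma cond_mutual_info2_eq_cmi:
  fixes X :: "'a \<Rightarrow> 'b::countable" and Y :: "'a \<Rightarrow> 'c::countable" and Z :: "'a \<Rightarrow> 'd::countable"
  assumes "finite (set_pmf p)"
  shows "cond_mutual_info2 p X Y Z = cmi p X Y Z"
proof -
  interpret information_space "measure_pmf p" 2 by (rule information_space_measure_pmf)
  have "cond_mutual_info2 p X Y Z = mi p X (\<lambda>a. (Y a, Z a)) - mi p X Z"
    by (simp add: prob_space.conditional_mutual_information_def[OF measure_pmf.prob_space_axioms]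
       pair_count_space_UNIV mutual_info2_eq_mi assms)
  then show ?thesis by (simp add: mi_def cmi_def)
qed

section \<open>An erasure channel that is less noisy than a binary symmetric channel\<close>

text \<open>Relative entropy, in nats, of a coin of bias \<open>x\<close> with respect to a coin of
  bias \<open>q\<close>.\<close>

definition kl_bin :: "real \<Rightarrow> real \<Rightarrow> real" where
  "kl_bin x q = x * (ln x - ln q) + (1 - x) * (ln (1 - x) - ln (1 - q))"

text \<open>
  The difference of the two sides is differentiated in \<open>q\<close>, not in \<open>x\<close>: its derivative is \<open>q - x\<close> times
  a nonnegative factor. Degenerate arguments are covered since \<open>0 * ln 0 = 0\<close>.
\<close>

lemma kl_bin_bsc_le:
  assumes x: "0 \<le> x" "x \<le> 1" and q: "0 \<le> q" "q \<le> 1" and q0: "q = 0 \<Longrightarrow> x = 0" and q1: "q = 1 \<Longrightarrow> x = 1"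
  shows "kl_bin (1/5 + 3/5 * x) (1/5 + 3/5 * q) \<le> kl_bin x q / 2"
proof (cases "q = 0 \<or> q = 1")
  case True
  then show ?thesis using q0 q1 by (auto simp: kl_bin_def)
next
  case False
  then have q: "0 < q" "q < 1" using q by auto
  \<comment> \<open>\<open>r t\<close> is the output bias of the binary symmetric channel with
    crossover probability 1/5 on an input of bias \<open>t\<close>.\<close>
  define r where "r t = 1/5 + 3/5 * t" for t :: real
  define G where "G t = kl_bin x t / 2 - kl_bin (r x) (r t)" for t
  define G' where "G' t = (- x / t + (1 - x) / (1 - t)) / 2 - 3/5 * (- r x / r t + (1 - r x) / (1
    - r t))" for t
  \<comment> \<open>At an endpoint the hypotheses force \<open>x\<close> to equal that endpoint, so
    the singular logarithm has coefficient 0 and its term is constant.\<close>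
  have deriv: "(G has_real_derivative G' t) (at t)"
    if t: "0 \<le> t" "t \<le> 1" "t = 0 \<Longrightarrow> x = 0" "t = 1 \<Longrightarrow> x = 1" for t
  proof -
    have 1: "((\<lambda>t. x * (ln x - ln t)) has_real_derivative - x / t) (at t)"
    proof (cases "t = 0")
      case False
      then show ?thesis using t by (auto intro!: derivative_eq_intros)
    qed (use t in simp)
    have 2: "((\<lambda>t. (1 - x) * (ln (1 - x) - ln (1 - t))) has_real_derivative (1 - x) / (1 - t)) (at t)"
    proof (cases "t = 1")
      case False
      then show ?thesis using t by (auto intro!: derivative_eq_intros simp: field_simps)
    qed (use t in simp)
    have rt: "0 < r t" "r t < 1" using t by (auto simp: r_def)
    have dr: "(r has_real_derivative 3/5) (at t)"
      unfolding r_def by (auto intro!: derivative_eq_intros)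
    have 3: "((\<lambda>t. r x * (ln (r x) - ln (r t))) has_real_derivative 3/5 * (- r x / r t)) (at t)"
      using rt by (auto intro!: derivative_eq_intros dr)
    have 4: "((\<lambda>t. (1 - r x) * (ln (1 - r x) - ln (1 - r t))) has_real_derivative 3/5 * ((1
      - r x) / (1 - r t))) (at t)"
      using rt by (auto intro!: derivative_eq_intros dr simp: divide_simps)
    show ?thesis
      unfolding G_def G'_def kl_bin_def
      by (rule DERIV_cong[OF DERIV_diff[OF DERIV_cdivide[OF DERIV_add[OF 1 2]] DERIV_add[OF 3 4]]])
        (simp add: algebra_simps)
  qed
  have G'_eq: "G' t = (t - x) * (1 / (2 * (t * (1 - t))) - 9/25 / (r t * (1 - r t)))"
    if t: "0 < t" "t < 1" for t
  proof -
    have rt: "r t > 0" "1 - r t > 0" using t by (auto simp: r_def)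
    have 1: "- x / t + (1 - x) / (1 - t) = (t - x) / (t * (1 - t))" using t by (simp add: field_simps)
    have "- r x / r t + (1 - r x) / (1 - r t) = (r t - r x) / (r t * (1 - r t))" using rt
      by (simp add: field_simps)
    also have "r t - r x = 3/5 * (t - x)" by (simp add: r_def)
    finally have 2: "- r x / r t + (1 - r x) / (1 - r t) = 3/5 * (t - x) / (r t * (1 - r t))" .
    have "u / A / 2 - 3/5 * (3/5 * u / B) = u * (1 / (2 * A) - 9/25 / B)" if "A \<noteq> 0" "B \<noteq> 0"
      for u A B :: real
      using that by (simp add: field_simps)
    from this[of "t * (1 - t)" "r t * (1 - r t)" "t - x"] show ?thesis unfolding G'_def 1 2 using t rt by simp
  qed
  \<comment> \<open>Clearing denominators leaves \<open>t * (1 - t) \<le> 4/9\<close>; the square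
    supplies the stronger bound 1/4.\<close>
  have factor: "1 / (2 * (t * (1 - t))) - 9/25 / (r t * (1 - r t)) \<ge> 0" if t: "0 < t" "t < 1" for t
  proof -
    have sq: "0 \<le> (t - 1/2)\<^sup>2" by simp
    have a: "0 < t * (1 - t)" using t by simp
    have b: "r t * (1 - r t) = 9/25 * (t * (1 - t)) + 4/25" by (simp add: r_def field_simps)
    have "9/25 / (r t * (1 - r t)) \<le> 1 / (2 * (t * (1 - t)))"
      unfolding b using a sq by (simp add: field_simps power2_eq_square)
    then show ?thesis by simp
  qed
  \<comment> \<open>\<open>G\<close> vanishes at \<open>x\<close>, and its derivative has the sign
    of \<open>t - x\<close>, so it does not decrease when moving from \<open>x\<close> towards
    \<open>q\<close> on either side.\<close>
  have "G x \<le> G q"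
  proof (cases "x \<le> q")
    case True
    show ?thesis
    proof (rule DERIV_nonneg_imp_nondecreasing[OF True])
      fix t assume t: "x \<le> t" "t \<le> q"
      have d: "(G has_real_derivative G' t) (at t)" using t x q by (intro deriv) auto
      have "0 \<le> G' t"
      proof (cases "t = 0")
        case True
        then have "x = 0" using t x by simp
        then show ?thesis using True by (simp add: G'_def r_def)
      next
        case False
        then show ?thesis using G'_eq[of t] factor[of t] t x q by simp
      qed
      with d show "\<exists>y. (G has_real_derivative y) (at t) \<and> 0 \<le> y" by blast
    qed
  next
    case False
    then have qx: "q \<le> x" by simp
    show ?thesis
    proof (rule DERIV_nonpos_imp_nonincreasing[OF qx])
      fix t assume t: "q \<le> t" "t \<le> x"
      have d: "(G has_real_derivative G' t) (at t)" using t x q by (intro deriv) auto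
      have "G' t \<le> 0"
      proof (cases "t = 1")
        case True
        then have "x = 1" using t x by simp
        then show ?thesis using True by (simp add: G'_def r_def)
      next
        case False
        then show ?thesis using G'_eq[of t] factor[of t] t x q by (simp add: mult_nonpos_nonneg)
      qed
      with d show "\<exists>y. (G has_real_derivative y) (at t) \<and> y \<le> 0" by blast
    qed
  qed
  moreover have "G x = 0" by (simp add: G_def kl_bin_def)
  ultimately show ?thesis by (simp add: G_def r_def)
qed

section \<open>Posteriors of the input bit and divergences of the output laws\<close>

definition posterior :: "'a pmf \<Rightarrow> ('a \<Rightarrow> 'b) \<Rightarrow> ('a \<Rightarrow> bool) \<Rightarrow> 'a \<Rightarrow> real" where
  "posterior p F T a = measure_pmf.prob p {b. F b = F a \<and> T b} / cell p F a"

text \<open>The output law of the channel \<open>w\<close> when its input is \<open>True\<close>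
  with probability \<open>q\<close>.\<close>

definition mixture :: "(bool \<Rightarrow> 'o pmf) \<Rightarrow> real \<Rightarrow> 'o \<Rightarrow> real" where
  "mixture w q y = (1 - q) * pmf (w False) y + q * pmf (w True) y"

lemma posterior_bounds:
  assumes "a \<in> set_pmf p"
  shows "0 \<le> posterior p F T a" "posterior p F T a \<le> 1"
proof -
  have "measure_pmf.prob p {b. F b = F a \<and> T b} \<le> cell p F a"
    unfolding cell_def by (intro measure_pmf.finite_measure_mono) auto
  then show "posterior p F T a \<le> 1" using cell_pos[OF assms, of F] by (simp add: posterior_def)
qed (simp add: posterior_def cell_nonneg)

lemma posterior_eq_0_iff:
  assumes "a \<in> set_pmf p"
  shows "posterior p F T a = 0 \<longleftrightarrow> (\<forall>b\<in>set_pmf p. F b = F a \<longrightarrow> \<not> T b)"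
  using cell_pos[OF assms, of F]
  by (auto simp: posterior_def measure_pmf.prob_eq_0 AE_measure_pmf_iff)

lemma one_minus_posterior:
  assumes "a \<in> set_pmf p"
  shows "1 - posterior p F T a = posterior p F (\<lambda>a. \<not> T a) a"
proof -
  have "cell p F a = measure_pmf.prob p ({b. F b = F a \<and> T b} \<union> {b. F b = F a \<and> \<not> T b})"
    unfolding cell_def by (intro arg_cong2[where f=measure]) auto
  also have "\<dots> = measure_pmf.prob p {b. F b = F a \<and> T b} + measure_pmf.prob p {b. F b = F a
    \<and> \<not> T b}"
    by (intro measure_pmf.finite_measure_Union) auto
  finally show ?thesis using cell_pos[OF assms, of F]
    by (simp add: posterior_def field_simps)
qed

text \<open>Hypothesis \<open>ch\<close> says that \<open>(F, Y)\<close> is distributed as if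
  \<open>Y\<close> were drawn afresh from \<open>w (T a)\<close>. Given \<open>F\<close>, the law of
  \<open>Y\<close> is therefore the mixture at the posterior of \<open>T\<close>.\<close>

lemma cell_channel:
  assumes fin: "finite (set_pmf p)"
    and ch: "map_pmf (\<lambda>a. (F a, Y a)) p = bind_pmf p (\<lambda>a. map_pmf (\<lambda>y. (F a, y)) (w (T a)))"
    and a: "a \<in> set_pmf p"
  shows "measure_pmf.prob p {b. F b = F a \<and> Y b = y} = cell p F a * mixture w (posterior p F T a) y"
proof -
  have pm: "pmf (map_pmf (\<lambda>y. (F b, y)) (w (T b))) (F a, y) = (if F b
    = F a then pmf (w (T b)) y else 0)" for b
  proof (cases "F b = F a")
    case True
    have "pmf (map_pmf (\<lambda>y. (F b, y)) (w (T b))) (F b, y) = pmf (w (T b)) y"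
      by (rule pmf_map_inj') (auto intro: injI)
    then show ?thesis using True by simp
  next
    case False
    then show ?thesis by (auto simp: pmf_eq_0_set_pmf)
  qed
  have "measure_pmf.prob p {b. F b = F a \<and> Y b = y} = pmf (map_pmf (\<lambda>a. (F a, Y a)) p) (F a, y)"
    by (auto simp: pmf_map vimage_def)
  also have "\<dots> = measure_pmf.expectation p (\<lambda>b. if F b = F a then pmf (w (T b)) y else 0)"
    unfolding ch pmf_bind pm ..
  also have "\<dots> = (\<Sum>b\<in>set_pmf p. pmf p b * (if F b = F a then pmf (w (T b)) y else 0))"
    by (simp add: sum_set_pmf_eq_expectation[OF fin])
  also have "\<dots> = (\<Sum>b\<in>set_pmf p. pmf (w True) y * (if b \<in> {b. F b = F a \<and> T b} then pmf p b else 0)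
      + pmf (w False) y * (if b \<in> {b. F b = F a \<and> \<not> T b} then pmf p b else 0))"
    by (intro sum.cong) (auto split: bool.splits)
  also have "\<dots> = pmf (w True) y * measure_pmf.prob p {b. F b = F a \<and> T b}
    + pmf (w False) y * measure_pmf.prob p {b. F b = F a \<and> \<not> T b}"
    unfolding prob_eq_sum[OF fin] by (simp add: sum.distrib sum_distrib_left)
  also have "\<dots> = cell p F a * mixture w (posterior p F T a) y"
    unfolding mixture_def one_minus_posterior[OF a, of F T] using cell_pos[OF a, of F]
      by (simp add: posterior_def field_simps)
  finally show ?thesis .
qed

text \<open>Tower property: \<open>Y\<close> is averaged first, conditionally on \<open>F\<close>,
  on which alone the functions \<open>g\<close> depend.\<close>

lemma sum_tower:
  fixes Y :: "'a \<Rightarrow> 'o::finite"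
  assumes fin: "finite (set_pmf p)"
    and g: "\<And>a b y. F a = F b \<Longrightarrow> g a y = (g b y :: real)"
  shows "(\<Sum>a\<in>set_pmf p. pmf p a * g a (Y a))
    = (\<Sum>b\<in>set_pmf p. pmf p b * (\<Sum>y\<in>UNIV. measure_pmf.prob p {a. F a = F b \<and> Y a
      = y} / cell p F b * g b y))"
proof -
  let ?S = "set_pmf p"
  have "(\<Sum>b\<in>?S. pmf p b * (\<Sum>y\<in>UNIV. measure_pmf.prob p {a. F a = F b \<and> Y a
    = y} / cell p F b * g b y))
    = (\<Sum>b\<in>?S. \<Sum>y\<in>UNIV. \<Sum>a\<in>?S.
      if F a = F b \<and> Y a = y then pmf p b * (pmf p a / cell p F b) * g b y else 0)"
    unfolding prob_eq_sum[OF fin]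
    by (auto simp: sum_distrib_left sum_divide_distrib sum_distrib_right intro!: sum.cong)
  also have "\<dots> = (\<Sum>b\<in>?S. \<Sum>a\<in>?S. \<Sum>y\<in>UNIV. if F a = F b \<and> Y a
    = y then pmf p b * (pmf p a / cell p F b) * g b y else 0)"
    by (intro sum.cong refl sum.swap)
  also have "\<dots> = (\<Sum>b\<in>?S. \<Sum>a\<in>?S. if F a
    = F b then pmf p b * (pmf p a / cell p F b) * g b (Y a) else 0)"
    by (intro sum.cong refl) (auto simp: sum.delta)
  also have "\<dots> = (\<Sum>a\<in>?S. \<Sum>b\<in>?S. if F b
    = F a then pmf p b * (pmf p a / cell p F a * g a (Y a)) else 0)"
    by (subst sum.swap, intro sum.cong refl) (auto cong: cell_cong g)
  also have "\<dots> = (\<Sum>a\<in>?S. cell p F a * (pmf p a / cell p F a * g a (Y a)))"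
  proof (intro sum.cong refl)
    fix a
    have "cell p F a * k = (\<Sum>b\<in>?S. if F b = F a then pmf p b * k else 0)" for k
      unfolding cell_eq_sum[OF fin] by (auto simp: sum_distrib_right intro!: sum.cong)
    then show "(\<Sum>b\<in>?S. if F b = F a then pmf p b * (pmf p a / cell p F a * g a (Y a)) else 0)
      = cell p F a * (pmf p a / cell p F a * g a (Y a))" ..
  qed
  also have "\<dots> = (\<Sum>a\<in>?S. pmf p a * g a (Y a))"
    using cell_pos[of _ p F] by (intro sum.cong refl) (simp add: less_imp_neq[symmetric])
  finally show ?thesis ..
qed

text \<open>The information is the mean divergence between the output law at the posterior given
  \<open>(V, S)\<close> and the one at the posterior given \<open>S\<close>. The posteriors do not
  involve the channel, so two channels can be compared pointwise.\<close>

lemma cmi_channel: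
  fixes Y :: "'a \<Rightarrow> 'o::finite"
  assumes fin: "finite (set_pmf p)"
    and ch: "map_pmf (\<lambda>a. ((V a, S a), Y a)) p
      = bind_pmf p (\<lambda>a. map_pmf (\<lambda>y. ((V a, S a), y)) (w (T a)))"
  shows "cmi p V Y S = (\<Sum>b\<in>set_pmf p. pmf p b *
    (\<Sum>y\<in>UNIV. mixture w (posterior p (\<lambda>a. (V a, S a)) T b) y * log 2 (mixture w (posterior p (\<lambda>a.
      (V a, S a)) T b) y / mixture w (posterior p S T b) y)))"
proof -
  let ?VS = "\<lambda>a. (V a, S a)"
  have chS: "map_pmf (\<lambda>a. (S a, Y a)) p = bind_pmf p (\<lambda>a. map_pmf (\<lambda>y. (S a, y)) (w (T a)))"
  proof -
    have "map_pmf (\<lambda>a. (S a, Y a)) p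
      = map_pmf (\<lambda>x. (snd (fst x), snd x)) (map_pmf (\<lambda>a. (?VS a, Y a)) p)"
      by (simp add: map_pmf_comp)
    also have "\<dots> = bind_pmf p (\<lambda>a. map_pmf (\<lambda>y. (S a, y)) (w (T a)))"
      unfolding ch by (simp add: map_bind_pmf map_pmf_comp)
    finally show ?thesis .
  qed
  have 1: "cell p (\<lambda>a. (V a, Y a, S a)) a
    = cell p ?VS a * mixture w (posterior p ?VS T a) (Y a)" if "a \<in> set_pmf p" for a
    using cell_channel[OF fin ch that, of "Y a"] by (simp add: cell_def conj_ac)
  have 2: "cell p (\<lambda>a. (Y a, S a)) a = cell p S a * mixture w (posterior p S T a) (Y a)"
    if "a \<in> set_pmf p" for a
    using cell_channel[OF fin chS that, of "Y a"] by (simp add: cell_def conj_ac)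
  define g where "g b y = log 2 (mixture w (posterior p ?VS T b) y / mixture w (posterior p S T b) y)" for b y
  have "cmi p V Y S = (\<Sum>a\<in>set_pmf p. pmf p a * g a (Y a))"
    unfolding cmi_eq_sum
  proof (intro sum.cong refl arg_cong2[where f="(*)"])
    fix a assume a: "a \<in> set_pmf p"
    note P = cell_pos[OF a, of "\<lambda>a. (V a, Y a, S a)"] cell_pos[OF a, of "\<lambda>a. (Y a, S a)"]
      cell_pos[OF a, of S] cell_pos[OF a, of ?VS]
    then have "0 < mixture w (posterior p ?VS T a) (Y a)" "0 < mixture w (posterior p S T a) (Y a)"
      unfolding 1[OF a] 2[OF a] by (simp_all add: zero_less_mult_iff)
    with P show "log 2 (cell p (\<lambda>a. (V a, Y a, S a)) a) + log 2 (cell p S a)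
      - log 2 (cell p ?VS a) - log 2 (cell p (\<lambda>a. (Y a, S a)) a) = g a (Y a)"
      unfolding 1[OF a] 2[OF a] g_def by (simp add: log_mult log_divide)
  qed
  also have "\<dots> = (\<Sum>b\<in>set_pmf p. pmf p b * (\<Sum>y\<in>UNIV. measure_pmf.prob p {a. ?VS a = ?VS b \<and> Y a
    = y} / cell p ?VS b * g b y))"
    by (rule sum_tower[OF fin]) (auto simp: g_def posterior_def cell_def)
  also have "\<dots> = (\<Sum>b\<in>set_pmf p. pmf p b * (\<Sum>y\<in>UNIV. mixture w (posterior p ?VS T b) y * g b y))"
  proof (intro sum.cong refl arg_cong2[where f="(*)"])
    fix b y assume b: "b \<in> set_pmf p"
    show "measure_pmf.prob p {a. ?VS a = ?VS b \<and> Y a = y} / cell p ?VS b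
      = mixture w (posterior p ?VS T b) y"
      using cell_channel[OF fin ch b, of y] cell_pos[OF b, of ?VS] by simp
  qed
  finally show ?thesis by (simp add: g_def)
qed

definition erasure :: "bool \<Rightarrow> bool option pmf" where
  "erasure t = map_pmf (\<lambda>b. if b then Some t else None) (bernoulli_pmf (1/2))"

text \<open>The Boolean \<open>b = t\<close> is \<open>t\<close> if \<open>b\<close> holds and the
  negation of \<open>t\<close> otherwise, so the crossover probability is 1/5.\<close>

definition bsc :: "bool \<Rightarrow> bool pmf" where
  "bsc t = map_pmf (\<lambda>b. b = t) (bernoulli_pmf (4/5))"

lemma pmf_erasure:
  "pmf (erasure t) None = 1/2" "pmf (erasure t) (Some s) = (if s = t then 1/2 else 0)"
proof -
  have "(\<lambda>b. if b then Some t else None) -` {None} = {False}" by (auto split: if_splits)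
  then show "pmf (erasure t) None = 1/2" by (simp add: erasure_def pmf_map measure_pmf_single)
  have "(\<lambda>b. if b then Some t else None) -` {Some s} = (if s = t then {True} else {})"
    by (auto split: if_splits)
  then show "pmf (erasure t) (Some s) = (if s = t then 1/2 else 0)"
    by (simp add: erasure_def pmf_map measure_pmf_single)
qed

lemma pmf_bsc: "pmf (bsc t) s = (if s = t then 4/5 else 1/5)"
proof -
  have "(\<lambda>b. b = t) -` {s} = {s = t}" by auto
  then show ?thesis by (simp add: bsc_def pmf_map measure_pmf_single)
qed

lemma UNIV_bool_option: "(UNIV :: bool option set) = {None, Some False, Some True}"
  by (auto simp: UNIV_option_conv UNIV_bool)

text \<open>By \<open>cmi_channel\<close> both sides average over the same pairs of posteriors
  \<open>x\<close> and \<open>q\<close>. The erasure channel yields half of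
  \<open>kl_bin x q\<close>, the symmetric channel the divergence of the contracted biases, and
  \<open>kl_bin_bsc_le\<close> compares them.\<close>

lemma less_noisy_single:
  assumes fin: "finite (set_pmf p)"
    and Z: "map_pmf (\<lambda>a. ((V a, S a), Z a)) p
      = bind_pmf p (\<lambda>a. map_pmf (\<lambda>y. ((V a, S a), y)) (erasure (T a)))"
    and J: "map_pmf (\<lambda>a. ((V a, S a), J a)) p
      = bind_pmf p (\<lambda>a. map_pmf (\<lambda>y. ((V a, S a), y)) (bsc (T a)))"
  shows "cmi p V J S \<le> cmi p V Z S"
  unfolding cmi_channel[OF fin Z] cmi_channel[OF fin J]
proof (intro sum_mono mult_left_mono)
  fix b assume b: "b \<in> set_pmf p"
  define x where "x = posterior p (\<lambda>a. (V a, S a)) T b"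
  define q where "q = posterior p S T b"
  have x: "0 \<le> x" "x \<le> 1" and q: "0 \<le> q" "q \<le> 1" using posterior_bounds[OF b]
    by (auto simp: x_def q_def)
  \<comment> \<open>The cells of \<open>(V, S)\<close> refine those of \<open>S\<close>, so a
    degenerate coarse posterior forces the fine one to be degenerate in the same way. This is the
    support condition of \<open>kl_bin_bsc_le\<close>.\<close>
  have q0: "x = 0" if "q = 0" using that unfolding x_def q_def posterior_eq_0_iff[OF b] by auto
  have q1: "x = 1" if "q = 1"
  proof -
    have "posterior p S (\<lambda>a. \<not> T a) b = 0" using that one_minus_posterior[OF b, of S T]
      by (simp add: q_def)
    then have "posterior p (\<lambda>a. (V a, S a)) (\<lambda>a. \<not> T a) b = 0"
      unfolding posterior_eq_0_iff[OF b] by auto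
    then show ?thesis using one_minus_posterior[OF b, of "\<lambda>a. (V a, S a)" T] by (simp add: x_def)
  qed
  have lg: "s * log 2 (s / t) = s * (ln s - ln t) / ln 2" if "0 \<le> s" "0 \<le> t" "t = 0 \<longrightarrow> s = 0"
    for s t :: real
    using that by (cases "s = 0") (auto simp: log_def ln_div)
  have mj: "mixture bsc c True = 1/5 + 3/5 * c" "mixture bsc c False = 1 - (1/5 + 3/5 * c)" for c
    by (simp_all add: mixture_def pmf_bsc field_simps)
  have mz: "mixture erasure c None = 1/2" "mixture erasure c (Some True)
    = c / 2" "mixture erasure c (Some False) = (1 - c) / 2" for c
    by (simp_all add: mixture_def pmf_erasure field_simps)
  have J: "(\<Sum>y\<in>UNIV. mixture bsc x y * log 2 (mixture bsc x y / mixture bsc q y)) = kl_bin (1/5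
    + 3/5 * x) (1/5 + 3/5 * q) / ln 2"
  proof -
    have "(\<Sum>y\<in>UNIV. mixture bsc x y * log 2 (mixture bsc x y / mixture bsc q y))
      = mixture bsc x True * log 2 (mixture bsc x True / mixture bsc q True)
        + mixture bsc x False * log 2 (mixture bsc x False / mixture bsc q False)"
      by (simp add: UNIV_bool)
    then show ?thesis using x q unfolding mj kl_bin_def
      by (subst (asm) lg, simp, simp, simp, subst (asm) lg, simp, simp, simp) (simp add: add_divide_distrib)
  qed
  have half: "log 2 (c / 2 / (d / 2)) = log 2 (c / d)" for c d :: real by simp
  \<comment> \<open>The erasure symbol has probability 1/2 under both biases and contributes
    nothing; the other two symbols give the divergence with weight 1/2.\<close>
  have Z: "(\<Sum>y\<in>UNIV. mixture erasure x y * log 2 (mixture erasure x y / mixture erasure q y))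
    = kl_bin x q / 2 / ln 2"
  proof -
    have "(\<Sum>y\<in>UNIV. mixture erasure x y * log 2 (mixture erasure x y / mixture erasure q y))
      = x * log 2 (x / q) / 2 + (1 - x) * log 2 ((1 - x) / (1 - q)) / 2"
      unfolding UNIV_bool_option
        by (simp add: mz half del: divide_divide_eq_right divide_divide_eq_left' divide_divide_eq_left)
    also have "\<dots> = kl_bin x q / 2 / ln 2"
      using x q q0 q1 unfolding kl_bin_def
      by (subst lg, simp, simp, simp, subst lg, simp, simp, simp) (simp add: add_divide_distrib mult.commute)
    finally show ?thesis .
  qed
  have "kl_bin (1/5 + 3/5 * x) (1/5 + 3/5 * q) / ln 2 \<le> kl_bin x q / 2 / ln 2"
    by (intro divide_right_mono kl_bin_bsc_le x q q0 q1) auto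
  then show "(\<Sum>y\<in>UNIV. mixture bsc (posterior p (\<lambda>a. (V a, S a)) T b) y * log 2 (mixture bsc
    (posterior p (\<lambda>a. (V a, S a)) T b) y / mixture bsc (posterior p S T b) y))
     \<le> (\<Sum>y\<in>UNIV. mixture erasure (posterior p (\<lambda>a. (V a, S a)) T b) y * log 2 (mixture erasure
       (posterior p (\<lambda>a. (V a, S a)) T b) y / mixture erasure (posterior p S T b) y))"
    using J Z by (simp add: x_def q_def)
qed auto

section \<open>Tensorization\<close>

primrec chan_list :: "('t \<Rightarrow> 'o pmf) \<Rightarrow> 't list \<Rightarrow> 'o list pmf" where
  "chan_list w [] = return_pmf []"
| "chan_list w (t # ts) = do { y \<leftarrow> w t; ys \<leftarrow> chan_list w ts; return_pmf (y # ys) }"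

lemma chan_list_hd_tl:
  assumes "ts \<noteq> []"
  shows "chan_list w ts = do { y \<leftarrow> w (hd ts); ys \<leftarrow> chan_list w (tl ts); return_pmf (y # ys) }"
  using assms by (cases ts) auto

lemma finite_chan_list: "(\<And>t. finite (set_pmf (w t))) \<Longrightarrow> finite (set_pmf (chan_list w ts))"
  by (induction ts) auto

lemma finite_erasure: "finite (set_pmf (erasure t))"
  and finite_bsc: "finite (set_pmf (bsc t))"
  by (simp_all add: erasure_def bsc_def)

definition chan_law :: "(bool \<Rightarrow> 'o pmf) \<Rightarrow> ('v \<times> 'u \<times> bool list) pmf \<Rightarrow> ('v \<times> 'u \<times> 'o list) pmf" where
  "chan_law w base = do { (v, u, ts) \<leftarrow> base; ys \<leftarrow> chan_list w ts; return_pmf (v, u, ys) }"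

lemma finite_chan_law:
  "finite (set_pmf base) \<Longrightarrow> (\<And>t. finite (set_pmf (w t))) \<Longrightarrow> finite (set_pmf (chan_law w base))"
  by (auto simp: chan_law_def split_beta finite_chan_list)

lemma cmi_chan_law_Nil:
  fixes w :: "bool \<Rightarrow> 'o pmf"
  assumes "\<And>v u ts. (v, u, ts) \<in> set_pmf base \<Longrightarrow> ts = []"
  shows "cmi (chan_law w base) fst (\<lambda>a. snd (snd a)) (\<lambda>a. fst (snd a)) = 0"
proof -
  let ?q = "map_pmf (\<lambda>(v, u, ts). (v, u, [] :: 'o list)) base"
  have "chan_law w base = ?q"
    unfolding chan_law_def map_pmf_def
  proof (intro bind_pmf_cong refl)
    fix x assume "x \<in> set_pmf base"
    then have "snd (snd x) = []" using assms[of "fst x" "fst (snd x)" "snd (snd x)"] by simp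
    then show "(case x of (v, u, ts) \<Rightarrow> chan_list w ts \<bind> (\<lambda>ys. return_pmf (v, u, ys)))
      = return_pmf (case x of (v, u, ts) \<Rightarrow> (v, u, []))"
      by (simp add: split_beta bind_return_pmf)
  qed
  moreover have "ent ?q (\<lambda>a. (snd (snd a), fst (snd a))) = ent ?q (\<lambda>a. fst (snd a))"
    "ent ?q (\<lambda>a. (fst a, snd (snd a), fst (snd a))) = ent ?q (\<lambda>a. (fst a, fst (snd a)))"
    by (intro ent_cong; auto simp: split_beta)+
  ultimately show ?thesis by (simp add: cmi_def)
qed

text \<open>
  The induction moves one channel output into the conditioning variable \<open>u\<close>; coding \<open>u\<close> by natural
  numbers keeps its type fixed.
\<close>

lemma less_noisy_tensor_nat:
  fixes base :: "('v \<times> nat \<times> bool list) pmf"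
  assumes "finite (set_pmf base)" and "\<And>v u ts. (v, u, ts) \<in> set_pmf base \<Longrightarrow> length ts = n"
  shows "cmi (chan_law bsc base) fst (\<lambda>a. snd (snd a)) (\<lambda>a. fst (snd a))
    \<le> cmi (chan_law erasure base) fst (\<lambda>a. snd (snd a)) (\<lambda>a. fst (snd a))"
  using assms
proof (induction n arbitrary: base)
  case 0
  then show ?case by (simp add: cmi_chan_law_Nil)
next
  case (Suc n)
  note fin = Suc.prems(1)
  \<comment> \<open>The induction hypothesis is applied to the remaining \<open>n\<close> letters,
    with the first symmetric-channel output as additional side information.\<close>
  define base' where "base' = do { (v, u, ts) \<leftarrow> base; j \<leftarrow> bsc (hd ts);
    return_pmf (v, to_nat (u, j), tl ts) }"
  \<comment> \<open>A common space carrying the outputs of both channels for the first letter and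
    for the rest, all drawn independently given the inputs.\<close>
  define p where "p = do { (v, u, ts) \<leftarrow> base; z \<leftarrow> erasure (hd ts); j \<leftarrow> bsc (hd ts);
     zr \<leftarrow> chan_list erasure (tl ts); jr \<leftarrow> chan_list bsc (tl ts);
       return_pmf (v, u, hd ts, z, j, zr, jr) }"
  have finp: "finite (set_pmf p)"
    unfolding p_def using fin by (auto simp: split_beta finite_chan_list finite_erasure finite_bsc)
  have IH: "cmi (chan_law bsc base') fst (\<lambda>a. snd (snd a)) (\<lambda>a. fst (snd a))
      \<le> cmi (chan_law erasure base') fst (\<lambda>a. snd (snd a)) (\<lambda>a. fst (snd a))"
  proof (rule Suc.IH)
    show "finite (set_pmf base')" unfolding base'_def using fin by (auto simp: split_beta finite_bsc)
    show "length ts = n" if "(v, u, ts) \<in> set_pmf base'" for v u ts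
      using that Suc.prems(2) unfolding base'_def by fastforce
  qed
  define v where "v a = fst a"
    for a :: "'v \<times> nat \<times> bool \<times> bool option \<times> bool \<times> bool option list \<times> bool list"
  define u where "u a = fst (snd a)"
    for a :: "'v \<times> nat \<times> bool \<times> bool option \<times> bool \<times> bool option list \<times> bool list"
  define t where "t a = fst (snd (snd a))"
    for a :: "'v \<times> nat \<times> bool \<times> bool option \<times> bool \<times> bool option list \<times> bool list"
  define z where "z a = fst (snd (snd (snd a)))"
    for a :: "'v \<times> nat \<times> bool \<times> bool option \<times> bool \<times> bool option list \<times> bool list"
  define j where "j a = fst (snd (snd (snd (snd a))))"
    for a :: "'v \<times> nat \<times> bool \<times> bool option \<times> bool \<times> bool option list \<times> bool list"
  define zr where "zr a = fst (snd (snd (snd (snd (snd a)))))"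
    for a :: "'v \<times> nat \<times> bool \<times> bool option \<times> bool \<times> bool option list \<times> bool list"
  define jr where "jr a = snd (snd (snd (snd (snd (snd a)))))"
    for a :: "'v \<times> nat \<times> bool \<times> bool option \<times> bool \<times> bool option list \<times> bool list"
  note coords = v_def[abs_def] u_def[abs_def] t_def[abs_def] z_def[abs_def] j_def[abs_def]
    zr_def[abs_def] jr_def[abs_def]
  note monad = map_bind_pmf bind_assoc_pmf bind_return_pmf map_return_pmf split_beta bind_pmf_const
  have ne: "snd (snd x) \<noteq> []" if "x \<in> set_pmf base" for x
    using Suc.prems(2)[of "fst x" "fst (snd x)" "snd (snd x)"] that by auto
  have L1: "chan_law bsc base = map_pmf (\<lambda>a. (v a, u a, j a # jr a)) p"
    unfolding chan_law_def p_def coords monad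
    by (intro bind_pmf_cong refl) (simp add: chan_list_hd_tl ne monad)
  have L2: "chan_law erasure base = map_pmf (\<lambda>a. (v a, u a, z a # zr a)) p"
    unfolding chan_law_def p_def coords monad
    by (intro bind_pmf_cong refl) (simp add: chan_list_hd_tl ne monad)
  have L3: "chan_law bsc base' = map_pmf (\<lambda>a. (v a, to_nat (u a, j a), jr a)) p"
    unfolding chan_law_def p_def base'_def coords by (simp add: monad)
  have L4: "chan_law erasure base' = map_pmf (\<lambda>a. (v a, to_nat (u a, j a), zr a)) p"
    unfolding chan_law_def p_def base'_def coords by (simp add: monad)
  \<comment> \<open>Given the latent bits, \<open>zr\<close> comes from the later letters only, so
    \<open>z\<close> (and likewise \<open>j\<close> below) is a fresh channel output even with
    \<open>zr\<close> in the conditioning.\<close>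
  have SZ: "map_pmf (\<lambda>a. ((v a, (u a, zr a)), z a)) p
    = bind_pmf p (\<lambda>a. map_pmf (\<lambda>y. ((v a, (u a, zr a)), y)) (erasure (t a)))"
    unfolding p_def coords
    by (simp add: monad) (simp add: map_pmf_def bind_commute_pmf[of "erasure _" "chan_list _ _"])
  have SJ: "map_pmf (\<lambda>a. ((v a, (u a, zr a)), j a)) p
    = bind_pmf p (\<lambda>a. map_pmf (\<lambda>y. ((v a, (u a, zr a)), y)) (bsc (t a)))"
    unfolding p_def coords
    by (simp add: monad) (simp add: map_pmf_def bind_commute_pmf[of "bsc _" "chan_list _ _"])
  \<comment> \<open>A hybrid argument: the tail outputs are exchanged first while \<open>j\<close>
    is conditioned on, then the first output is exchanged while \<open>zr\<close> is conditioned
    on.\<close>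
  have "cmi (chan_law bsc base) fst (\<lambda>a. snd (snd a)) (\<lambda>a. fst (snd a))
    = cmi p v (\<lambda>a. (j a, jr a)) u"
    unfolding L1 cmi_map[OF finp] by (intro cmi_cong) auto
  also have "\<dots> = cmi p v j u + cmi p v jr (\<lambda>a. (u a, j a))" by (rule cmi_chain)
  also have "cmi p v jr (\<lambda>a. (u a, j a)) \<le> cmi p v zr (\<lambda>a. (u a, j a))"
  proof -
    have "cmi p v jr (\<lambda>a. (u a, j a))
      = cmi (chan_law bsc base') fst (\<lambda>a. snd (snd a)) (\<lambda>a. fst (snd a))"
      unfolding L3 cmi_map[OF finp] by (intro cmi_cong) auto
    moreover have "cmi p v zr (\<lambda>a. (u a, j a))
      = cmi (chan_law erasure base') fst (\<lambda>a. snd (snd a)) (\<lambda>a. fst (snd a))"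
      unfolding L4 cmi_map[OF finp] by (intro cmi_cong) auto
    ultimately show ?thesis using IH by simp
  qed
  also have "cmi p v j u + cmi p v zr (\<lambda>a. (u a, j a)) = cmi p v (\<lambda>a. (j a, zr a)) u"
    by (rule cmi_chain[symmetric])
  also have "\<dots> = cmi p v (\<lambda>a. (zr a, j a)) u" by (intro cmi_cong) auto
  also have "\<dots> = cmi p v zr u + cmi p v j (\<lambda>a. (u a, zr a))" by (rule cmi_chain)
  also have "cmi p v j (\<lambda>a. (u a, zr a)) \<le> cmi p v z (\<lambda>a. (u a, zr a))"
    by (rule less_noisy_single[OF finp SZ SJ])
  also have "cmi p v zr u + cmi p v z (\<lambda>a. (u a, zr a)) = cmi p v (\<lambda>a. (zr a, z a)) u"
    by (rule cmi_chain[symmetric])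
  also have "\<dots> = cmi (chan_law erasure base) fst (\<lambda>a. snd (snd a)) (\<lambda>a. fst (snd a))"
    unfolding L2 cmi_map[OF finp] by (intro cmi_cong) auto
  finally show ?case by simp
qed

lemma less_noisy_tensor:
  fixes base :: "('v \<times> 'u::countable \<times> bool list) pmf"
  assumes fin: "finite (set_pmf base)" and len: "\<And>v u ts. (v, u, ts) \<in> set_pmf base \<Longrightarrow> length ts = n"
  shows "cmi (chan_law bsc base) fst (\<lambda>a. snd (snd a)) (\<lambda>a. fst (snd a))
    \<le> cmi (chan_law erasure base) fst (\<lambda>a. snd (snd a)) (\<lambda>a. fst (snd a))"
proof -
  define base' where "base' = map_pmf (\<lambda>(v, u, ts). (v, to_nat u, ts)) base"
  have law: "chan_law w base' = map_pmf (\<lambda>(v, u, ts). (v, to_nat u, ts)) (chan_law w base)"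
    for w :: "bool \<Rightarrow> 'o pmf"
    by (simp add: chan_law_def base'_def bind_map_pmf map_bind_pmf split_beta)
  have c: "cmi (chan_law w base') fst (\<lambda>a. snd (snd a)) (\<lambda>a. fst (snd a))
      = cmi (chan_law w base) fst (\<lambda>a. snd (snd a)) (\<lambda>a. fst (snd a))" if "\<And>t. finite (set_pmf (w
        t))" for w :: "bool \<Rightarrow> 'o pmf"
    unfolding law cmi_map[OF finite_chan_law[OF fin that]] by (intro cmi_cong) auto
  have "cmi (chan_law bsc base') fst (\<lambda>a. snd (snd a)) (\<lambda>a. fst (snd a))
    \<le> cmi (chan_law erasure base') fst (\<lambda>a. snd (snd a)) (\<lambda>a. fst (snd a))"
    by (rule less_noisy_tensor_nat) (use fin len in \<open>auto simp: base'_def\<close>)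
  then show ?thesis by (simp add: c finite_erasure finite_bsc)
qed

section \<open>Public discussion\<close>

text \<open>\<open>A\<close> and \<open>B\<close> are the parties' views, that is, input and private
  randomness; \<open>J\<close> is further data held by the eavesdropper. Each message is determined
  by one view and the history, so \<open>cmi_message_le\<close> applies; the arbitrary initial
  history \<open>h\<close> carries the induction.\<close>

lemma cmi_transcript_le:
  assumes fin: "finite (set_pmf p)"
  shows "cmi p A B (\<lambda>w. (J w, transcript ms (fst (A w)) (snd (A w)) (fst (B w)) (snd (B w)) (h w)))
    \<le> cmi p A B (\<lambda>w. (J w, h w))"
proof (induction ms arbitrary: h)
  case Nil
  then show ?case by simp
next
  case (Cons m ms)
  have step: "cmi p A B (\<lambda>w. (J w, h w @ [g w])) \<le> cmi p A B (\<lambda>w. (J w, h w))"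
    if g: "(\<forall>a b. A a = A b \<longrightarrow> h a = h b \<longrightarrow> g a = g b) \<or> (\<forall>a b. B a = B b \<longrightarrow> h a = h b \<longrightarrow> g a
      = g b)" for g
  proof -
    have "cmi p A B (\<lambda>w. (J w, h w @ [g w])) = cmi p A B (\<lambda>w. ((J w, h w), g w))"
      by (intro cmi_cong) auto
    also have "\<dots> \<le> cmi p A B (\<lambda>w. (J w, h w))"
      using g
    proof
      assume "\<forall>a b. A a = A b \<longrightarrow> h a = h b \<longrightarrow> g a = g b"
      then show ?thesis by (intro cmi_message_le fin) blast
    next
      assume "\<forall>a b. B a = B b \<longrightarrow> h a = h b \<longrightarrow> g a = g b"
      then show ?thesis unfolding cmi_commute[of p A B] by (intro cmi_message_le fin) blast
    qed
    finally show ?thesis .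
  qed
  show ?case
  proof (cases m)
    case (From_Alice f)
    let ?g = "\<lambda>w. f (fst (A w)) (snd (A w)) (h w)"
    have "cmi p A B (\<lambda>w. (J w, transcript (m # ms) (fst (A w)) (snd (A w)) (fst (B w)) (snd (B w))
      (h w)))
      \<le> cmi p A B (\<lambda>w. (J w, h w @ [?g w]))"
      unfolding From_Alice transcript.simps by (rule Cons.IH)
    also have "\<dots> \<le> cmi p A B (\<lambda>w. (J w, h w))" by (rule step) auto
    finally show ?thesis .
  next
    case (From_Bob f)
    let ?g = "\<lambda>w. f (fst (B w)) (snd (B w)) (h w)"
    have "cmi p A B (\<lambda>w. (J w, transcript (m # ms) (fst (A w)) (snd (A w)) (fst (B w)) (snd (B w))
      (h w)))
      \<le> cmi p A B (\<lambda>w. (J w, h w @ [?g w]))"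
      unfolding From_Bob transcript.simps by (rule Cons.IH)
    also have "\<dots> \<le> cmi p A B (\<lambda>w. (J w, h w))" by (rule step) auto
    finally show ?thesis .
  qed
qed

text \<open>Both outputs are replaced by the full views through data processing, after which the
  transcript is removed from the conditioning message by message.\<close>

lemma cmi_discussion_le:
  assumes fin: "finite (set_pmf p)"
    and C: "C = (\<lambda>w. transcript ms (fst (A w)) (snd (A w)) (fst (B w)) (snd (B w)) [])"
  shows "cmi p (\<lambda>w. f (A w) (C w)) (\<lambda>w. g (B w) (C w)) (\<lambda>w. (J w, C w)) \<le> cmi p A B J"
proof -
  have "cmi p (\<lambda>w. f (A w) (C w)) (\<lambda>w. g (B w) (C w)) (\<lambda>w. (J w, C w))
      \<le> cmi p A (\<lambda>w. g (B w) (C w)) (\<lambda>w. (J w, C w))"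
    by (rule cmi_data_processing[OF fin]) auto
  also have "\<dots> = cmi p (\<lambda>w. g (B w) (C w)) A (\<lambda>w. (J w, C w))" by (rule cmi_commute)
  also have "\<dots> \<le> cmi p B A (\<lambda>w. (J w, C w))"
    by (rule cmi_data_processing[OF fin]) auto
  also have "\<dots> = cmi p A B (\<lambda>w. (J w, C w))" by (rule cmi_commute)
  also have "\<dots> \<le> cmi p A B (\<lambda>w. (J w, []::nat list))"
    unfolding C by (rule cmi_transcript_le[OF fin])
  also have "\<dots> = cmi p A B J" by (intro cmi_cong) auto
  finally show ?thesis .
qed

section \<open>Conditional independence given a recorded index\<close>

lemma pmf_bind_tagged:
  "pmf (bind_pmf q (\<lambda>j. map_pmf (\<lambda>a. (a, j)) (w j))) (a, j) = pmf q j * pmf (w j) a"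
proof -
  have "pmf (map_pmf (\<lambda>a. (a, i)) (w i)) (a, j) = (if i = j then pmf (w j) a else 0)" for i
  proof (cases "i = j")
    case True
    have "pmf (map_pmf (\<lambda>a. (a, j)) (w j)) (a, j) = pmf (w j) a"
      by (rule pmf_map_inj') (auto intro: injI)
    then show ?thesis using True by simp
  qed (auto simp: pmf_eq_0_set_pmf)
  then have "pmf (bind_pmf q (\<lambda>j. map_pmf (\<lambda>a. (a, j)) (w j))) (a, j) = (\<integral>i. (if i
    = j then pmf (w j) a else 0) \<partial>measure_pmf q)"
    by (simp add: pmf_bind)
  also have "\<dots> = (\<Sum>i\<in>{j}. (if i = j then pmf (w j) a else 0) * pmf q i)"
    by (rule integral_measure_pmf_real) (auto split: if_splits)
  finally show ?thesis by simp
qed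

text \<open>All four cell probabilities factor through \<open>q\<close>, \<open>u\<close> and
  \<open>w\<close>, so every summand of \<open>cmi_eq_sum\<close> vanishes.\<close>

lemma cmi_conditionally_independent:
  "cmi (do { j \<leftarrow> q; a \<leftarrow> u j; b \<leftarrow> w j;
    return_pmf (a, b, j) }) fst (\<lambda>x. fst (snd x)) (\<lambda>x. snd (snd x)) = 0"
proof -
  define p where "p = do { j \<leftarrow> q; a \<leftarrow> u j; b \<leftarrow> w j; return_pmf (a, b, j) }"
  note monad = map_bind_pmf bind_assoc_pmf bind_return_pmf map_return_pmf bind_pmf_const
  have L0: "map_pmf (\<lambda>x. ((fst x, fst (snd x)), snd (snd x))) p
    = bind_pmf q (\<lambda>j. map_pmf (\<lambda>a. (a, j)) (pair_pmf (u j) (w j)))"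
    unfolding p_def by (simp add: monad pair_pmf_def)
  have L1: "map_pmf (\<lambda>x. (fst x, snd (snd x))) p = bind_pmf q (\<lambda>j. map_pmf (\<lambda>a. (a, j)) (u j))"
    unfolding p_def by (simp add: monad) (simp add: map_pmf_def)
  have L2: "map_pmf (\<lambda>x. (fst (snd x), snd (snd x))) p
    = bind_pmf q (\<lambda>j. map_pmf (\<lambda>a. (a, j)) (w j))"
    unfolding p_def by (simp add: monad) (simp add: map_pmf_def)
  have L3: "map_pmf (\<lambda>x. snd (snd x)) p = q"
    unfolding p_def by (simp add: monad bind_return_pmf')
  have "cmi p fst (\<lambda>x. fst (snd x)) (\<lambda>x. snd (snd x)) = (\<Sum>x\<in>set_pmf p. 0)"
    unfolding cmi_eq_sum
  proof (intro sum.cong refl)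
    fix x assume x: "x \<in> set_pmf p"
    obtain a b j where abj: "x = (a, b, j)" by (cases x) auto
    have c0: "cell p (\<lambda>x. (fst x, fst (snd x), snd (snd x))) x = pmf q j * (pmf (u j) a * pmf (w j) b)"
    proof -
      have "cell p (\<lambda>x. (fst x, fst (snd x), snd (snd x))) x
        = cell p (\<lambda>x. ((fst x, fst (snd x)), snd (snd x))) x"
        by (rule cell_eqI) auto
      also have "\<dots> = pmf q j * (pmf (u j) a * pmf (w j) b)"
        unfolding cell_eq_pmf_map L0 abj by (simp add: pmf_bind_tagged pmf_pair)
      finally show ?thesis .
    qed
    have c1: "cell p (\<lambda>x. (fst x, snd (snd x))) x = pmf q j * pmf (u j) a"
      unfolding cell_eq_pmf_map L1 abj by (simp add: pmf_bind_tagged)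
    have c2: "cell p (\<lambda>x. (fst (snd x), snd (snd x))) x = pmf q j * pmf (w j) b"
      unfolding cell_eq_pmf_map L2 abj by (simp add: pmf_bind_tagged)
    have c3: "cell p (\<lambda>x. snd (snd x)) x = pmf q j"
      unfolding cell_eq_pmf_map L3 abj by simp
    have "0 < pmf q j" "0 < pmf (u j) a" "0 < pmf (w j) b"
      using cell_pos[OF x, of "\<lambda>x. (fst x, fst (snd x), snd (snd x))"] unfolding c0
      by (auto simp: zero_less_mult_iff pmf_nonneg not_less[symmetric] dest: order.strict_trans1)
    then show "pmf p x * (log 2 (cell p (\<lambda>x. (fst x, fst (snd x), snd (snd x))) x)
      + log 2 (cell p (\<lambda>x. snd (snd x)) x)
       - log 2 (cell p (\<lambda>x. (fst x, snd (snd x))) x)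
         - log 2 (cell p (\<lambda>x. (fst (snd x), snd (snd x))) x)) = 0"
      unfolding c0 c1 c2 c3 by (simp add: log_mult)
  qed
  then show ?thesis by (simp add: p_def)
qed

section \<open>The latent bit of the source\<close>

lemma finite_replicate_pmf:
  assumes "finite (set_pmf p)" shows "finite (set_pmf (replicate_pmf n p))"
  unfolding set_replicate_pmf using finite_lists_length_eq[OF assms, of n]
  by (simp add: lists_eq_set conj_commute)

primrec triples :: "nat \<Rightarrow> ('x \<times> 'y \<times> 'z) pmf \<Rightarrow> ('x list \<times> 'y list \<times> 'z list) pmf" where
  "triples 0 p = return_pmf ([], [], [])"
| "triples (Suc n) p = do { (x, y, z) \<leftarrow> p; (xs, ys, zs) \<leftarrow> triples n p;
  return_pmf (x # xs, y # ys, z # zs) }"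

lemma triples_eq_map:
  "map_pmf (\<lambda>l. (map fst l, map (fst \<circ> snd) l, map (snd \<circ> snd) l)) (replicate_pmf n p)
    = triples n p"
proof (induction n)
  case (Suc n)
  show ?case
    unfolding triples.simps Suc.IH[symmetric]
    by (simp add: map_bind_pmf bind_map_pmf o_def) (auto intro!: bind_pmf_cong)
qed simp

text \<open>Applying a memoryless channel to independent copies is the same as taking copies of the
  single-letter law. An identity between single-letter laws thus lifts to \<open>n\<close>
  copies.\<close>

lemma triples_channel:
  "do { bs \<leftarrow> replicate_pmf n B; ys \<leftarrow> chan_list w (map T bs); return_pmf (map X bs, map Y bs, ys) }
    = triples n (do { b \<leftarrow> B; y \<leftarrow> w (T b); return_pmf (X b, Y b, y) })"
proof (induction n)
  case 0
  then show ?case by (simp add: bind_return_pmf)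
next
  case (Suc n)
  show ?case
    unfolding triples.simps Suc.IH[symmetric]
    by (simp add: bind_assoc_pmf bind_return_pmf bind_commute_pmf[of "replicate_pmf n B" "w _"])
qed

text \<open>Independent draws are commuted one at a time until the three draws of the first letter
  stand in front.\<close>

lemma triples_two_channels:
  "do { js \<leftarrow> replicate_pmf n U; xs \<leftarrow> chan_list u js; ys \<leftarrow> chan_list w js; return_pmf (xs, ys, js) }
    = triples n (do { j \<leftarrow> U; x \<leftarrow> u j; y \<leftarrow> w j; return_pmf (x, y, j) })"
proof (induction n)
  case 0
  then show ?case by (simp add: bind_return_pmf)
next
  case (Suc n)
  have "do { js \<leftarrow> replicate_pmf (Suc n) U; xs \<leftarrow> chan_list u js; ys \<leftarrow> chan_list w js;
    return_pmf (xs, ys, js) }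
    = do { j \<leftarrow> U; js \<leftarrow> replicate_pmf n U; x \<leftarrow> u j; xs \<leftarrow> chan_list u js; y \<leftarrow> w j;
      ys \<leftarrow> chan_list w js; return_pmf (x # xs, y # ys, j # js) }"
    by (simp add: bind_assoc_pmf bind_return_pmf)
  also have "\<dots> = do { j \<leftarrow> U; js \<leftarrow> replicate_pmf n U; x \<leftarrow> u j; y \<leftarrow> w j; xs \<leftarrow> chan_list u js;
    ys \<leftarrow> chan_list w js; return_pmf (x # xs, y # ys, j # js) }"
    by (subst bind_commute_pmf[of "chan_list u _" "w _"]) (rule refl)
  also have "\<dots> = do { j \<leftarrow> U; x \<leftarrow> u j; js \<leftarrow> replicate_pmf n U; y \<leftarrow> w j; xs \<leftarrow> chan_list u js;
    ys \<leftarrow> chan_list w js; return_pmf (x # xs, y # ys, j # js) }"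
    by (subst bind_commute_pmf[of "replicate_pmf n U" "u _"]) (rule refl)
  also have "\<dots> = do { j \<leftarrow> U; x \<leftarrow> u j; y \<leftarrow> w j; js \<leftarrow> replicate_pmf n U; xs \<leftarrow> chan_list u js;
    ys \<leftarrow> chan_list w js; return_pmf (x # xs, y # ys, j # js) }"
    by (subst bind_commute_pmf[of "replicate_pmf n U" "w _"]) (rule refl)
  also have "\<dots> = triples (Suc n) (do { j \<leftarrow> U; x \<leftarrow> u j; y \<leftarrow> w j; return_pmf (x, y, j) })"
    unfolding triples.simps Suc.IH[symmetric] by (simp add: bind_assoc_pmf bind_return_pmf)
  finally show ?case .
qed

text \<open>The third component is the latent bit. The weight 5/9 is the probability of
  \<open>X = Y\<close>: the diagonal entries of the three matrices add up to 20/36.\<close>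

definition latent_source :: "(bool \<times> bool \<times> bool) pmf" where
  "latent_source = do { x \<leftarrow> bernoulli_pmf (1/2); e \<leftarrow> bernoulli_pmf (5/9); f \<leftarrow> bernoulli_pmf (1/2);
     return_pmf (x, if e then x else \<not> x, if e then x else f) }"

text \<open>Given the bit \<open>j\<close>, each of \<open>X\<close> and \<open>Y\<close> equals
  \<open>j\<close> with probability 2/3, independently; they then agree with probability 4/9 + 1/9 =
  5/9.\<close>

definition side_channel :: "bool \<Rightarrow> bool pmf" where
  "side_channel j = bernoulli_pmf (if j then 2/3 else 1/3)"

lemma finite_latent_source: "finite (set_pmf latent_source)"
  by (rule finite_subset[OF subset_UNIV]) simp

text \<open>In the second description, \<open>X = Y\<close> makes the odds that \<open>j\<close> is
  their common value 4 : 1, matching the crossover 1/5, and \<open>X \<noteq> Y\<close> makes the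
  odds even, matching the fair latent bit.\<close>

lemma latent_source_bsc:
  "do { b \<leftarrow> latent_source; j \<leftarrow> bsc (snd (snd b)); return_pmf (fst b, fst (snd b), j) }
    = do { j \<leftarrow> bernoulli_pmf (1/2); x \<leftarrow> side_channel j; y \<leftarrow> side_channel j; return_pmf (x, y, j) }"
proof (rule pmf_eqI)
  fix a :: "bool \<times> bool \<times> bool"
  obtain x y j where a: "a = (x, y, j)" by (cases a) auto
  show "pmf (do { b \<leftarrow> latent_source; j \<leftarrow> bsc (snd (snd b)); return_pmf (fst b, fst (snd b), j) }) a
    = pmf (do { j \<leftarrow> bernoulli_pmf (1/2); x \<leftarrow> side_channel j; y \<leftarrow> side_channel j;
      return_pmf (x, y, j) }) a"
    unfolding a latent_source_def side_channel_def bsc_def map_pmf_def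
    by (cases x; cases y; cases j) (simp_all add: bind_assoc_pmf bind_return_pmf pmf_bind indicator_def)
qed

locale source =
  fixes P :: "(bool \<times> bool \<times> bool option) pmf"
  assumes M0: "\<And>x y. pmf P (x, y, Some False) = [[5, 2], [2, 0]] ! of_bool x ! of_bool y / 36"
    and M1: "\<And>x y. pmf P (x, y, Some True) = [[0, 2], [2, 5]] ! of_bool x ! of_bool y / 36"
    and Mbot: "\<And>x y. pmf P (x, y, None) = [[5, 4], [4, 5]] ! of_bool x ! of_bool y / 36"
begin

lemma latent_source_erasure:
  "do { b \<leftarrow> latent_source; z \<leftarrow> erasure (snd (snd b)); return_pmf (fst b, fst (snd b), z) } = P"
proof (rule pmf_eqI)
  fix a :: "bool \<times> bool \<times> bool option"
  obtain x y z where a: "a = (x, y, z)" by (cases a) auto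
  have z: "z = None \<or> z = Some False \<or> z = Some True" by (cases z) auto
  show "pmf (do { b \<leftarrow> latent_source; z \<leftarrow> erasure (snd (snd b));
    return_pmf (fst b, fst (snd b), z) }) a = pmf P a"
    unfolding a latent_source_def erasure_def map_pmf_def
    using z by (cases x; cases y; elim disjE)
      (simp_all add: bind_assoc_pmf bind_return_pmf pmf_bind indicator_def M0 M1 Mbot)
qed

section \<open>Key agreement against the real and the fictitious eavesdropper\<close>

definition transcript_of :: "('x list, 'y list, nat, nat) protocol \<Rightarrow> 'x list \<times> nat \<Rightarrow> 'y list \<times> nat
  \<Rightarrow> nat list" where
  "transcript_of \<pi> a b = transcript (messages \<pi>) (fst a) (snd a) (fst b) (snd b) []"

text \<open>Alice's view, Bob's view, and the outputs of \<open>w\<close> on the latent bits. With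
  \<open>erasure\<close> the third component is \<open>Z^n\<close>; with \<open>bsc\<close> it is
  the fictitious eavesdropper's \<open>J^n\<close>.\<close>

definition discussion :: "(bool \<Rightarrow> 'o pmf) \<Rightarrow> (bool list, bool list, nat, nat) protocol \<Rightarrow> nat
    \<Rightarrow> ((bool list \<times> nat) \<times> (bool list \<times> nat) \<times> 'o list) pmf" where
  "discussion w \<pi> n = do { (xs, ys, os) \<leftarrow> do { bs \<leftarrow> replicate_pmf n latent_source;
       os \<leftarrow> chan_list w (map (\<lambda>b. snd (snd b)) bs);
         return_pmf (map fst bs, map (\<lambda>b. fst (snd b)) bs, os) };
     r \<leftarrow> rand_A \<pi>; s \<leftarrow> rand_B \<pi>; return_pmf ((xs, r), (ys, s), os) }"

context
  fixes \<pi> :: "(bool list, bool list, nat, nat) protocol" and n :: nat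
  assumes rnd: "finite_randomness \<pi>"
begin

lemma finite_discussion:
  assumes "\<And>t. finite (set_pmf (w t))"
  shows "finite (set_pmf (discussion w \<pi> n))"
proof -
  have "finite (set_pmf (replicate_pmf n latent_source))"
    by (rule finite_replicate_pmf[OF finite_latent_source])
  then show ?thesis
    using assms rnd by (auto simp: discussion_def split_beta finite_chan_list finite_randomness_def)
qed

lemma key_law_eq_discussion:
  "key_law P n \<pi> = map_pmf (\<lambda>(a, b, zs). let c = transcript_of \<pi> a b in
     (out_A \<pi> (fst a) (snd a) c, out_B \<pi> (fst b) (snd b) c, zs, c)) (discussion erasure \<pi> n)"
proof -
  have "discussion erasure \<pi> n = do { (xs, ys, os) \<leftarrow> triples n P; r \<leftarrow> rand_A \<pi>;
    s \<leftarrow> rand_B \<pi>; return_pmf ((xs, r), (ys, s), os) }"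
    unfolding discussion_def triples_channel latent_source_erasure ..
  then show ?thesis
    unfolding triples_eq_map[symmetric] key_law_def run_def
    by (simp add: bind_map_pmf map_bind_pmf split_beta bind_assoc_pmf bind_return_pmf Let_def
      transcript_of_def o_def)
qed

text \<open>The source is rewritten as \<open>J^n\<close> followed by two separate side channels,
  after which the two views are drawn independently given \<open>J^n\<close>.\<close>

lemma discussion_bsc_independent:
  "cmi (discussion bsc \<pi> n) fst (\<lambda>a. fst (snd a)) (\<lambda>a. snd (snd a)) = 0"
proof -
  have "discussion bsc \<pi> n = do { (xs, ys, os) \<leftarrow> triples n (do { j \<leftarrow> bernoulli_pmf (1/2);
    x \<leftarrow> side_channel j; y \<leftarrow> side_channel j; return_pmf (x, y, j) });
      r \<leftarrow> rand_A \<pi>; s \<leftarrow> rand_B \<pi>; return_pmf ((xs, r), (ys, s), os) }"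
    unfolding discussion_def triples_channel latent_source_bsc ..
  also have "\<dots> = do { js \<leftarrow> replicate_pmf n (bernoulli_pmf (1/2)); xs \<leftarrow> chan_list side_channel js;
      ys \<leftarrow> chan_list side_channel js; r \<leftarrow> rand_A \<pi>; s \<leftarrow> rand_B \<pi>;
        return_pmf ((xs, r), (ys, s), js) }"
    unfolding triples_two_channels[symmetric] by (simp add: bind_assoc_pmf bind_return_pmf)
  also have "\<dots> = do { js \<leftarrow> replicate_pmf n (bernoulli_pmf (1/2)); xs \<leftarrow> chan_list side_channel js;
      r \<leftarrow> rand_A \<pi>; ys \<leftarrow> chan_list side_channel js; s \<leftarrow> rand_B \<pi>;
        return_pmf ((xs, r), (ys, s), js) }"
    by (subst bind_commute_pmf[of "rand_A \<pi>"]) (rule refl)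
  also have "\<dots> = do { js \<leftarrow> replicate_pmf n (bernoulli_pmf (1/2));
    a \<leftarrow> pair_pmf (chan_list side_channel js) (rand_A \<pi>);
      b \<leftarrow> pair_pmf (chan_list side_channel js) (rand_B \<pi>); return_pmf (a, b, js) }"
    by (simp add: pair_pmf_def bind_assoc_pmf bind_return_pmf)
  finally show ?thesis by (simp add: cmi_conditionally_independent)
qed

definition key_A where "key_A a
  = out_A \<pi> (fst (fst a)) (snd (fst a)) (transcript_of \<pi> (fst a) (fst (snd a)))"
definition key_B where "key_B a
  = out_B \<pi> (fst (fst (snd a))) (snd (fst (snd a))) (transcript_of \<pi> (fst a) (fst (snd a)))"
definition talk where "talk a = transcript_of \<pi> (fst a) (fst (snd a))"

text \<open>The key and the transcript depend on the two views only, so the channel on the latent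
  bits can be applied after them, and \<open>less_noisy_tensor\<close> compares the two
  channels.\<close>

lemma discussion_less_noisy:
  "cmi (discussion bsc \<pi> n) key_A (\<lambda>a. snd (snd a)) talk
    \<le> cmi (discussion erasure \<pi> n) key_A (\<lambda>a. snd (snd a)) talk"
proof -
  \<comment> \<open>The unit value fills the eavesdropper's slot, which \<open>key_A\<close> and
    \<open>talk\<close> ignore.\<close>
  define base where "base = do { bs \<leftarrow> replicate_pmf n latent_source; r \<leftarrow> rand_A \<pi>; s \<leftarrow> rand_B \<pi>;
     return_pmf (key_A ((map fst bs, r), (map (\<lambda>b. fst (snd b)) bs, s), ()), talk ((map fst bs, r),
       (map (\<lambda>b. fst (snd b)) bs, s), ()), map (\<lambda>b. snd (snd b)) bs) }"
  have law: "chan_law w base = map_pmf (\<lambda>a. (key_A a, talk a, snd (snd a))) (discussion w \<pi> n)"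
    for w :: "bool \<Rightarrow> 'o pmf"
  proof -
    have "chan_law w base = do { bs \<leftarrow> replicate_pmf n latent_source; r \<leftarrow> rand_A \<pi>; s \<leftarrow> rand_B \<pi>;
       os \<leftarrow> chan_list w (map (\<lambda>b. snd (snd b)) bs);
       return_pmf (key_A ((map fst bs, r), (map (\<lambda>b. fst (snd b)) bs, s), ()), talk ((map fst bs,
         r), (map (\<lambda>b. fst (snd b)) bs, s), ()), os) }"
      by (simp add: chan_law_def base_def bind_assoc_pmf bind_return_pmf)
    also have "\<dots> = do { bs \<leftarrow> replicate_pmf n latent_source;
       os \<leftarrow> chan_list w (map (\<lambda>b. snd (snd b)) bs); r \<leftarrow> rand_A \<pi>; s \<leftarrow> rand_B \<pi>;
       return_pmf (key_A ((map fst bs, r), (map (\<lambda>b. fst (snd b)) bs, s), ()), talk ((map fst bs,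
         r), (map (\<lambda>b. fst (snd b)) bs, s), ()), os) }"
      by (simp add: bind_commute_pmf[of _ "chan_list w _"])
    also have "\<dots> = map_pmf (\<lambda>a. (key_A a, talk a, snd (snd a))) (discussion w \<pi> n)"
      by (simp add: discussion_def map_bind_pmf split_beta bind_assoc_pmf bind_return_pmf key_A_def talk_def)
    finally show ?thesis .
  qed
  have fin: "finite (set_pmf (discussion w \<pi> n))" if "\<And>t. finite (set_pmf (w t))"
    for w :: "bool \<Rightarrow> 'o pmf"
    using that by (rule finite_discussion)
  have finb: "finite (set_pmf base)"
  proof -
    have "finite (set_pmf (replicate_pmf n latent_source))"
      by (rule finite_replicate_pmf[OF finite_latent_source])
    then show ?thesis using rnd by (simp add: base_def finite_randomness_def)
  qed
  have "cmi (chan_law bsc base) fst (\<lambda>a. snd (snd a)) (\<lambda>a. fst (snd a))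
    \<le> cmi (chan_law erasure base) fst (\<lambda>a. snd (snd a)) (\<lambda>a. fst (snd a))"
    by (rule less_noisy_tensor[OF finb, where n = n]) (auto simp: base_def set_replicate_pmf)
  then show ?thesis
    unfolding law by (simp add: cmi_map fin finite_erasure finite_bsc)
qed

text \<open>The joint law of the two views does not depend on the channel. Entropies of keys and
  transcript therefore carry over between the two eavesdroppers.\<close>

lemma ent_discussion_cong:
  fixes w :: "bool \<Rightarrow> 'o pmf" and w' :: "bool \<Rightarrow> 'u pmf"
  assumes w: "\<And>t. finite (set_pmf (w t))" and w': "\<And>t. finite (set_pmf (w' t))"
    and X: "\<And>a b os os'. X (a, b, os) = X' (a, b, os')"
  shows "ent (discussion w \<pi> n) X = ent (discussion w' \<pi> n) X'"
proof -
  define ab where "ab = do { bs \<leftarrow> replicate_pmf n latent_source; r \<leftarrow> rand_A \<pi>; s \<leftarrow> rand_B \<pi>;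
     return_pmf ((map fst bs, r), (map (\<lambda>b. fst (snd b)) bs, s)) }"
  define f where "f a = X (fst a, snd a, [])" for a
  have ab: "ab = map_pmf (\<lambda>a. (fst a, fst (snd a))) (discussion v \<pi> n)" for v :: "bool \<Rightarrow> 'v pmf"
    by (simp add: ab_def discussion_def map_bind_pmf split_beta bind_assoc_pmf bind_return_pmf)
  have "X = (\<lambda>a. f (fst a, fst (snd a)))" "X' = (\<lambda>a. f (fst a, fst (snd a)))"
    using X by (auto simp: f_def fun_eq_iff) metis+
  moreover have "ent (discussion w \<pi> n) (\<lambda>a. f (fst a, fst (snd a))) = ent ab f"
    unfolding ab[of w] using finite_discussion[of w] w by (simp add: ent_map)
  moreover have "ent (discussion w' \<pi> n) (\<lambda>a. f (fst a, fst (snd a))) = ent ab f"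
    unfolding ab[of w'] using finite_discussion[of w'] w' by (simp add: ent_map)
  ultimately show ?thesis by simp
qed

text \<open>With \<open>J\<close> the fictitious data and \<open>F\<close> the transcript:
  \<open>I(K_A; K_B)\<close> is at most \<open>I(K_A; J, F) + I(K_A; K_B | J, F)\<close>. The last
  term vanishes, since the views are independent given \<open>J\<close>, and
  \<open>I(K_A; J, F) \<le> I(K_A; Z, F)\<close> because \<open>Z\<close> is less noisy. Fano's
  inequality bounds the rest of the entropy of \<open>K_A\<close>.\<close>

lemma ent_key_le:
  assumes K: "finite K" "\<And>a r c. out_A \<pi> a r c \<in> K"
  shows "ent (key_law P n \<pi>) fst \<le> mi (key_law P n \<pi>) fst (snd \<circ> snd) + 1
    + measure_pmf.prob (key_law P n \<pi>) {(ka, kb, z, f). ka \<noteq> kb} * log 2 (card K)"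
proof -
  let ?q = "discussion bsc \<pi> n" and ?e = "discussion erasure \<pi> n"
  let ?J = "\<lambda>a. snd (snd a)"
  have finq: "finite (set_pmf ?q)" and fine: "finite (set_pmf ?e)"
    by (intro finite_discussion finite_bsc finite_erasure)+
  have kl: "key_law P n \<pi> = map_pmf (\<lambda>a. (key_A a, key_B a, snd (snd a), talk a)) ?e"
    unfolding key_law_eq_discussion by (intro map_pmf_cong) (auto simp: key_A_def key_B_def talk_def Let_def)
  have fink: "finite (set_pmf (key_law P n \<pi>))" unfolding kl using fine by simp
  have e1: "ent (key_law P n \<pi>) fst = ent ?e key_A"
    unfolding kl by (simp add: ent_map fine)
  have e2: "mi (key_law P n \<pi>) fst (snd \<circ> snd) = mi ?e key_A (\<lambda>a. (?J a, talk a))"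
    unfolding kl mi_def by (simp add: ent_map fine)
  have tr: "ent ?q key_A = ent ?e key_A" "ent ?q talk = ent ?e talk"
    "ent ?q (\<lambda>a. (key_A a, talk a)) = ent ?e (\<lambda>a. (key_A a, talk a))"
    "ent ?q key_B = ent ?e key_B"
    "ent ?q (\<lambda>a. (key_A a, key_B a)) = ent ?e (\<lambda>a. (key_A a, key_B a))"
    by (intro ent_discussion_cong finite_erasure finite_bsc; simp add: key_A_def key_B_def talk_def)+
  have z: "cmi ?q key_A key_B (\<lambda>a. (?J a, talk a)) \<le> 0"
  proof -
    have "cmi ?q (\<lambda>a. out_A \<pi> (fst (fst a)) (snd (fst a)) (talk a)) (\<lambda>a. out_B \<pi> (fst (fst (snd
      a))) (snd (fst (snd a))) (talk a)) (\<lambda>a. (?J a, talk a))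
      \<le> cmi ?q fst (\<lambda>a. fst (snd a)) ?J"
      by (rule cmi_discussion_le[OF finq, where f="\<lambda>a. out_A \<pi> (fst a) (snd a)" and g="\<lambda>a. out_B \<pi>
        (fst a) (snd a)" and ms="messages \<pi>"])
        (simp add: talk_def transcript_of_def fun_eq_iff)
    then show ?thesis unfolding discussion_bsc_independent
      by (simp add: key_A_def[abs_def] key_B_def[abs_def] talk_def[abs_def])
  qed
  have swap: "ent ?q (\<lambda>a. (key_A a, ?J a, talk a)) = ent ?q (\<lambda>a. (key_A a, talk a, ?J a))"
    for q by (intro ent_cong) auto
  have ln: "cmi ?q key_A ?J talk \<le> cmi ?e key_A ?J talk" by (rule discussion_less_noisy)
  have nn: "0 \<le> cmi ?q key_A (\<lambda>a. (?J a, talk a)) key_B" by (rule cmi_nonneg[OF finq])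
  have c: "ent ?q (\<lambda>a. ((?J a, talk a), key_B a)) = ent ?q (\<lambda>a. (key_B a, ?J a, talk a))"
    "ent ?q (\<lambda>a. (key_A a, (?J a, talk a), key_B a))
      = ent ?q (\<lambda>a. (key_A a, key_B a, ?J a, talk a))"
    by (intro ent_cong; auto)+
  have "ent ?e (\<lambda>a. (key_A a, key_B a)) - ent ?e key_B \<le> 1
    + measure_pmf.prob ?e {a. key_A a \<noteq> key_B a} * log 2 (card K)"
    using K by (intro fano fine) (auto simp: key_A_def)
  moreover have "measure_pmf.prob ?e {a. key_A a \<noteq> key_B a}
    = measure_pmf.prob (key_law P n \<pi>) {(ka, kb, z, f). ka \<noteq> kb}"
    unfolding kl by (simp add: vimage_def)
  ultimately have "ent ?e (\<lambda>a. (key_A a, key_B a)) - ent ?e key_B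
      \<le> 1 + measure_pmf.prob (key_law P n \<pi>) {(ka, kb, z, f). ka \<noteq> kb} * log 2 (card K)"
    by (simp only:)
  then show ?thesis
    using z ln nn unfolding e1 e2 unfolding cmi_def mi_def c tr by linarith
qed

end

end

section \<open>The secret-key rate\<close>

context source
begin

text \<open>Once the error is below 1/2 and the uniformity and secrecy defects are below 1, the
  length \<open>L\<close> of the key satisfies \<open>L < 1 + (1 + 1 + L / 2)\<close>, hence
  \<open>L < 6\<close>.\<close>

lemma admissible_log_card_bounded:
  assumes adm: "admissible P \<pi> K"
  shows "\<forall>\<^sub>F n in sequentially. log 2 (card (K n)) \<le> 6"
proof -
  let ?k = "\<lambda>n. key_law P n (\<pi> n)"
  let ?L = "\<lambda>n. log 2 (real (card (K n)))"
  have rnd: "finite_randomness (\<pi> n)" and K: "finite (K n)" "\<And>a r c. out_A (\<pi> n) a r c \<in> K n" for n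
    using adm by (auto simp: admissible_def)
  have fin: "finite (set_pmf (?k n))" for n
    unfolding key_law_eq_discussion[OF rnd] by (simp add: finite_discussion[OF rnd] finite_erasure)
  have eq1: "(\<lambda>n. measure_pmf.prob (?k n) {(ka, kb, z, f). ka = kb}) \<longlonglongrightarrow> 1"
    and eq2: "(\<lambda>n. ?L n - ent (?k n) fst) \<longlonglongrightarrow> 0"
    and eq3: "(\<lambda>n. mi (?k n) fst (snd \<circ> snd)) \<longlonglongrightarrow> 0"
    using adm by (simp_all add: admissible_def entropy2_eq_ent mutual_info2_eq_mi fin)
  have neq: "measure_pmf.prob (?k n) {(ka, kb, z, f). ka \<noteq> kb} = 1
    - measure_pmf.prob (?k n) {(ka, kb, z, f). ka = kb}" for n
    by (subst measure_pmf.prob_compl[symmetric]) (auto intro!: arg_cong2[where f=measure])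
  have "\<forall>\<^sub>F n in sequentially. measure_pmf.prob (?k n) {(ka, kb, z, f). ka = kb} > 1/2"
    using eq1 by (rule order_tendstoD) simp
  moreover have "\<forall>\<^sub>F n in sequentially. ?L n - ent (?k n) fst < 1"
    using eq2 by (rule order_tendstoD) simp
  moreover have "\<forall>\<^sub>F n in sequentially. mi (?k n) fst (snd \<circ> snd) < 1"
    using eq3 by (rule order_tendstoD) simp
  ultimately show ?thesis
  proof eventually_elim
    case (elim n)
    have L0: "0 \<le> ?L n"
    proof -
      have "out_A (\<pi> n) [] 0 [] \<in> K n" "finite (K n)" by (rule K)+
      then have "card (K n) \<noteq> 0" by auto
      then show ?thesis by simp
    qed
    have "ent (?k n) fst \<le> mi (?k n) fst (snd \<circ> snd) + 1
      + measure_pmf.prob (?k n) {(ka, kb, z, f). ka \<noteq> kb} * ?L n"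
      by (rule ent_key_le[OF rnd K])
    moreover have "measure_pmf.prob (?k n) {(ka, kb, z, f). ka \<noteq> kb} * ?L n \<le> 1/2 * ?L n"
      using elim L0 by (intro mult_right_mono) (simp_all add: neq)
    ultimately show ?case using elim by linarith
  qed
qed

lemma admissible_rate_0:
  assumes adm: "admissible P \<pi> K"
  shows "liminf (\<lambda>n. ereal (log 2 (card (K n)) / real n)) = 0"
proof -
  have L0: "0 \<le> log 2 (real (card (K n)))" for n
  proof -
    have "out_A (\<pi> n) [] 0 [] \<in> K n" "finite (K n)" using adm by (simp_all add: admissible_def)
    then have "card (K n) \<noteq> 0" by auto
    then show ?thesis by simp
  qed
  have "(\<lambda>n. log 2 (card (K n)) / real n) \<longlonglongrightarrow> 0"
  proof (rule tendsto_sandwich[where f="\<lambda>_. 0" and h="\<lambda>n. 6 / real n"])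
    show "\<forall>\<^sub>F n in sequentially. log 2 (card (K n)) / real n \<le> 6 / real n"
      using admissible_log_card_bounded[OF adm] by eventually_elim (simp add: divide_right_mono)
    show "(\<lambda>n. 6 / real n) \<longlonglongrightarrow> 0" by (rule lim_const_over_n)
  qed (simp_all add: L0)
  then have "(\<lambda>n. ereal (log 2 (card (K n)) / real n)) \<longlonglongrightarrow> ereal 0" by simp
  then show ?thesis by (subst lim_imp_Liminf) (simp_all add: zero_ereal_def)
qed

text \<open>A constant key in a one-point set. It keeps the supremum in
  \<open>secret_key_rate\<close> from being taken over the empty set, where it would be minus
  infinity.\<close>

lemma admissible_trivial: "\<exists>\<pi> K. admissible P \<pi> K"
proof -
  define \<pi> :: "(bool list, bool list, nat, nat) protocol" where
    "\<pi> = \<lparr>rand_A = return_pmf 0, rand_B = return_pmf 0, messages = [], out_A = (\<lambda>_ _ _. 0), out_B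
      = (\<lambda>_ _ _. 0)\<rparr>"
  have rnd: "finite_randomness \<pi>" by (simp add: finite_randomness_def \<pi>_def)
  have fin: "finite (set_pmf (key_law P n \<pi>))" for n
    unfolding key_law_eq_discussion[OF rnd] by (simp add: finite_discussion[OF rnd] finite_erasure)
  have supp: "fst a = 0 \<and> fst (snd a) = 0" if "a \<in> set_pmf (key_law P n \<pi>)" for a n
    using that by (auto simp: key_law_def run_def \<pi>_def bind_return_pmf)
  have 1: "measure_pmf.prob (key_law P n \<pi>) {(ka, kb, z, f). ka = kb} = 1" for n
    using supp[of _ n] by (subst measure_pmf.prob_eq_1) (auto simp: AE_measure_pmf_iff, metis)
  have 2: "entropy2 (key_law P n \<pi>) fst = 0" for n
    unfolding entropy2_eq_ent[OF fin] by (rule ent_const) (use supp in blast)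
  have 3: "mutual_info2 (key_law P n \<pi>) fst (snd \<circ> snd) = 0" for n
  proof -
    have "ent (key_law P n \<pi>) (\<lambda>a. (fst a, (snd \<circ> snd) a)) = ent (key_law P n \<pi>) (snd \<circ> snd)"
      by (intro ent_cong) (use supp[of _ n] in auto)
    then show ?thesis unfolding mutual_info2_eq_mi[OF fin] mi_def using 2[of n]
      by (simp add: entropy2_eq_ent[OF fin])
  qed
  have "admissible P (\<lambda>_. \<pi>) (\<lambda>_. {0})"
    unfolding admissible_def using 1 2 3 rnd by (simp add: \<pi>_def)
  then show ?thesis by blast
qed

lemma secret_key_rate_eq_0: "secret_key_rate P = 0"
proof -
  obtain \<pi> K where "admissible P \<pi> K" using admissible_trivial by blast
  then have "{liminf (\<lambda>n. ereal (log 2 (real (card (K n))) / real n)) | \<pi> K. admissible P \<pi> K}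
    = {0}"
    using admissible_rate_0 by (auto intro!: exI[of _ \<pi>] exI[of _ K])
  then show ?thesis by (simp add: secret_key_rate_def)
qed

end

section \<open>The intrinsic information\<close>

text \<open>
  From \<open>ln y \<le> y - 1\<close> at \<open>y = sqrt (r / p)\<close>; the terms \<open>p - r\<close> cancel in the sum over a joint law.
\<close>

lemma relative_entropy_term_ge:
  fixes p r m :: real
  assumes "0 \<le> p" "p \<le> m" "0 < r" "r \<le> m"
  shows "p * (ln p - ln r) \<ge> p - r + (p - r)\<^sup>2 / (4 * m)"
proof -
  define s where "s = sqrt p"
  define t where "t = sqrt r"
  have st: "0 \<le> s" "0 < t" "p = s\<^sup>2" "r = t\<^sup>2" using assms by (auto simp: s_def t_def)
  have m: "0 < m" using assms by simp
  have "p * (ln p - ln r) \<ge> (s - t)\<^sup>2 + p - r"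
  proof (cases "s = 0")
    case False
    then have s: "0 < s" using st by simp
    have "ln (t / s) \<le> t / s - 1" using s st by (intro ln_le_minus_one) auto
    then have "ln s - ln t \<ge> 1 - t / s" using s st by (simp add: ln_div)
    then have "2 * p * (ln s - ln t) \<ge> 2 * p * (1 - t / s)" using assms by (intro mult_left_mono) auto
    moreover have "p * (ln p - ln r) = 2 * p * (ln s - ln t)"
    proof -
      have "ln p - ln r = 2 * (ln s - ln t)" using s st by (simp add: ln_realpow)
      then show ?thesis by simp
    qed
    moreover have "2 * p * (1 - t / s) = (s - t)\<^sup>2 + p - r"
      using s st by (simp add: power2_eq_square field_simps)
    ultimately show ?thesis by linarith
  qed (use st in simp)
  moreover have "(s - t)\<^sup>2 \<ge> (p - r)\<^sup>2 / (4 * m)"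
  proof -
    have "(s + t)\<^sup>2 \<le> 2 * (s\<^sup>2 + t\<^sup>2)" using sum_squares_bound[of s t]
      by (simp add: power2_eq_square algebra_simps)
    also have "\<dots> \<le> 4 * m" using assms st by simp
    finally have "(s - t)\<^sup>2 * (s + t)\<^sup>2 \<le> (s - t)\<^sup>2 * (4 * m)" by (intro mult_left_mono) auto
    moreover have "(s - t)\<^sup>2 * (s + t)\<^sup>2 = (p - r)\<^sup>2" using st
      by (simp add: power2_eq_square algebra_simps)
    ultimately show ?thesis using m by (simp add: field_simps)
  qed
  ultimately show ?thesis by linarith
qed

text \<open>A bound linear in the weights is wanted, so that it can be summed over output letters.
  With \<open>u = a + c\<close> and \<open>v = b + c\<close> the squared quantity is
  \<open>(4 * u - v) * (4 * v - u)\<close>; both factors are at least \<open>3 * c - a - b\<close>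
  and their sum is \<open>3 * s\<close>.\<close>

lemma determinant_bound:
  fixes a b c :: real
  assumes "0 \<le> a" "0 \<le> b" "0 \<le> c" "0 < a + b + 2 * c"
  shows "(25 * (a + c) * (b + c) - 4 * (a + b + 2 * c)\<^sup>2)\<^sup>2 / (a + b + 2 * c)^3
    \<ge> 9/8 * (3 * c - a - b) - 9/64 * (a + b + 2 * c)"
proof -
  define s where "s = a + b + 2 * c"
  define D where "D = 25 * (a + c) * (b + c) - 4 * s\<^sup>2"
  define E where "E = 3 * c - a - b"
  have s: "0 < s" using assms by (simp add: s_def)
  have DE: "\<bar>D\<bar> \<ge> 3/2 * (s * E)"
  proof (cases "E \<le> 0")
    case True
    then have "s * E \<le> 0" using s by (simp add: mult_nonneg_nonpos)
    then show ?thesis by simp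
  next
    case False
    define f where "f = 4 * (a + c) - (b + c)"
    define g where "g = 4 * (b + c) - (a + c)"
    have fg: "f \<ge> E" "g \<ge> E" "f + g = 3 * s" using assms by (auto simp: f_def g_def E_def s_def)
    have D: "D = f * g" by (simp add: D_def f_def g_def s_def power2_eq_square algebra_simps)
    have "f \<ge> 3/2 * s \<or> g \<ge> 3/2 * s" using fg(3) by linarith
    then have "f * g \<ge> 3/2 * s * E"
    proof
      assume "f \<ge> 3/2 * s"
      then show ?thesis using fg False s by (intro mult_mono) auto
    next
      assume "g \<ge> 3/2 * s"
      then have "3/2 * s * E \<le> g * f" using fg False s by (intro mult_mono) auto
      then show ?thesis by (simp add: mult.commute)
    qed
    then show ?thesis using D by simp
  qed
  \<comment> \<open>The square is replaced by its tangent at \<open>3/8 * s\<close>. For slope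
    parameter \<open>t\<close> the total over all letters is \<open>3 * t - 4 * t^2\<close>, as
    \<open>E\<close> sums to 1 and \<open>s\<close> to 4; the choice 3/8 maximizes it.\<close>
  have "0 \<le> (\<bar>D\<bar> / s - 3/8 * s)\<^sup>2" by simp
  also have "\<dots> = D\<^sup>2 / s\<^sup>2 - 3/4 * \<bar>D\<bar> + 9/64 * s\<^sup>2"
    using s by (simp add: power2_diff power_divide power_mult_distrib)
  finally have "3/4 * (3/2 * (s * E)) - 9/64 * s\<^sup>2 \<le> D\<^sup>2 / s\<^sup>2" using DE by linarith
  then have "(9/8 * E - 9/64 * s) * s \<le> D\<^sup>2 / s\<^sup>2" by (simp add: power2_eq_square algebra_simps)
  then have "9/8 * E - 9/64 * s \<le> D\<^sup>2 / s\<^sup>2 / s" by (subst pos_le_divide_eq[OF s])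
  then show ?thesis by (simp add: D_def E_def s_def power2_eq_square power3_eq_cube)
qed

text \<open>The left side is the divergence, in nats, of the letter's weight matrix with rows
  \<open>(p0, p1)\<close> and \<open>(p1, p2)\<close> from the product of its marginals. All four
  deviations equal \<open>d\<close> up to sign, so the first-order terms cancel and the quadratic
  ones add up to \<open>d^2 / m\<close>.\<close>

lemma letter_bound:
  fixes a b c :: real
  assumes abc: "0 \<le> a" "0 \<le> b" "0 \<le> c"
  defines "p0 \<equiv> 5 * (a + c) / 36" and "p1 \<equiv> (2 * a + 2 * b + 4 * c) / 36" and "p2 \<equiv> 5 * (b
    + c) / 36"
  shows "p0 * (ln p0 + ln (p0 + 2 * p1 + p2) - ln (p0 + p1) - ln (p0 + p1))
     + 2 * (p1 * (ln p1 + ln (p0 + 2 * p1 + p2) - ln (p0 + p1) - ln (p1 + p2)))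
     + p2 * (ln p2 + ln (p0 + 2 * p1 + p2) - ln (p1 + p2) - ln (p1 + p2))
     \<ge> (64 / 1296\<^sup>2) * (9/8 * (3 * c - a - b) - 9/64 * (a + b + 2 * c))"
proof (cases "a + b + 2 * c = 0")
  case True
  then have "a = 0" "b = 0" "c = 0" using abc by auto
  then show ?thesis by (simp add: p0_def p1_def p2_def)
next
  case False
  then have s: "0 < a + b + 2 * c" using abc by auto
  define m where "m = p0 + 2 * p1 + p2"
  define x where "x = p0 + p1"
  define y where "y = p1 + p2"
  have p: "0 \<le> p0" "0 < p1" "0 \<le> p2" using abc s by (auto simp: p0_def p1_def p2_def)
  have xy: "0 < x" "0 < y" "m = x + y" using p by (auto simp: x_def y_def m_def)
  have m: "0 < m" using xy by simp
  have le: "x * x / m \<le> m" "x * y / m \<le> m" "y * y / m \<le> m"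
    using xy m by (auto simp: field_simps)
  have lns: "ln (x * x / m) = ln x + ln x - ln m" "ln (x * y / m) = ln x + ln y
    - ln m" "ln (y * y / m) = ln y + ln y - ln m"
    using xy m by (simp_all add: ln_mult ln_div)
  have 0: "p0 * (ln p0 - ln (x * x / m)) \<ge> p0 - x * x / m + (p0 - x * x / m)\<^sup>2 / (4 * m)"
    using p xy m le by (intro relative_entropy_term_ge) (auto simp: m_def)
  have 1: "p1 * (ln p1 - ln (x * y / m)) \<ge> p1 - x * y / m + (p1 - x * y / m)\<^sup>2 / (4 * m)"
    using p xy m le by (intro relative_entropy_term_ge) (auto simp: m_def)
  have 2: "p2 * (ln p2 - ln (y * y / m)) \<ge> p2 - y * y / m + (p2 - y * y / m)\<^sup>2 / (4 * m)"
    using p xy m le by (intro relative_entropy_term_ge) (auto simp: m_def)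
  define d where "d = (p0 * p2 - p1 * p1) / m"
  have d: "p0 - x * x / m = d" "p1 - x * y / m = - d" "p2 - y * y / m = d"
    using m by (simp_all add: d_def field_simps) (simp_all add: m_def x_def y_def algebra_simps)
  have "p0 * (ln p0 - ln (x * x / m)) + 2 * (p1 * (ln p1 - ln (x * y / m))) + p2 * (ln p2
    - ln (y * y / m)) \<ge> d\<^sup>2 / m"
    using 0 1 2 m unfolding d by (simp add: field_simps)
  also have "d\<^sup>2 / m = (64 / 1296\<^sup>2) * ((25 * (a + c) * (b + c) - 4 * (a + b + 2 * c)\<^sup>2)\<^sup>2 / (a
    + b + 2 * c)^3)"
  proof -
    have e1: "p0 * p2 - p1 * p1 = (25 * (a + c) * (b + c) - 4 * (a + b + 2 * c)\<^sup>2) / 1296"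
      by (simp add: p0_def p1_def p2_def power2_eq_square field_simps)
    have e2: "m = (a + b + 2 * c) / 4" by (simp add: m_def p0_def p1_def p2_def field_simps)
    have e3: "(D / 1296 / (s / 4))\<^sup>2 / (s / 4) = (64 / 1296\<^sup>2) * (D\<^sup>2 / s ^ 3)" for D s :: real
      by (simp add: power_divide power2_eq_square power3_eq_cube)
    show ?thesis unfolding d_def e1 e2 e3 ..
  qed
  finally have "p0 * (ln p0 - ln (x * x / m)) + 2 * (p1 * (ln p1 - ln (x * y / m))) + p2 * (ln p2
    - ln (y * y / m))
    \<ge> (64 / 1296\<^sup>2) * ((25 * (a + c) * (b + c) - 4 * (a + b + 2 * c)\<^sup>2)\<^sup>2 / (a + b + 2 * c)^3)" .
  moreover have "(64 / 1296\<^sup>2) * ((25 * (a + c) * (b + c) - 4 * (a + b + 2 * c)\<^sup>2)\<^sup>2 / (a + b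
    + 2 * c)^3)
    \<ge> (64 / 1296\<^sup>2) * (9/8 * (3 * c - a - b) - 9/64 * (a + b + 2 * c))"
    by (intro mult_left_mono determinant_bound abc s) simp
  moreover have "p0 * (ln p0 + ln m - ln x - ln x) + 2 * (p1 * (ln p1 + ln m - ln x - ln y))
    + p2 * (ln p2 + ln m - ln y - ln y)
    = p0 * (ln p0 - ln (x * x / m)) + 2 * (p1 * (ln p1 - ln (x * y / m))) + p2 * (ln p2 - ln (y * y / m))"
    unfolding lns by (simp add: algebra_simps)
  ultimately show ?thesis unfolding m_def[symmetric] x_def[symmetric] y_def[symmetric] by linarith
qed

lemma UNIV_bool_bool_option: "(UNIV :: (bool \<times> bool \<times> bool option) set) =
   {False, True} \<times> {False, True} \<times> {None, Some False, Some True}"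
  unfolding UNIV_bool[symmetric] UNIV_bool_option[symmetric] by simp

context source
begin

lemma intrinsic_lower_bound:
  fixes W :: "bool option \<Rightarrow> 'b pmf"
  assumes W: "\<And>z. finite (set_pmf (W z))"
  shows "cmi (do { (x, y, z) \<leftarrow> P; z' \<leftarrow> W z; return_pmf (x, y, z') }) fst (fst \<circ> snd) (snd \<circ> snd)
     \<ge> (64 / 1296\<^sup>2) * (9/16) / ln 2"
proof -
  define q where "q = do { (x, y, z) \<leftarrow> P; z' \<leftarrow> W z; return_pmf (x, y, z') }"
  define a where "a = pmf (W (Some False))"
  define b where "b = pmf (W (Some True))"
  define c where "c = pmf (W None)"
  define S where "S = (\<Union>z. set_pmf (W z))"
  have finS: "finite S" unfolding S_def using W by (intro finite_UN_I) auto
  have q: "pmf q (x, y, k) = pmf P (x, y, Some False) * a k + pmf P (x, y, Some True) * b k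
    + pmf P (x, y, None) * c k" for x y k
  proof -
    have one: "pmf (W z \<bind> (\<lambda>z'. return_pmf (x', y', z'))) (x, y, k) = (if x' = x \<and> y'
      = y then pmf (W z) k else 0)" for x' y' z
    proof -
      have "W z \<bind> (\<lambda>z'. return_pmf (x', y', z')) = map_pmf (\<lambda>z'. (x', y', z')) (W z)"
        by (simp add: map_pmf_def)
      moreover have "pmf (map_pmf (\<lambda>z'. (x, y, z')) (W z)) (x, y, k) = pmf (W z) k"
        by (rule pmf_map_inj') (auto intro: injI)
      ultimately show ?thesis by (auto simp: pmf_eq_0_set_pmf)
    qed
    have "pmf q (x, y, k) = (\<integral>e. (if fst e = x \<and> fst (snd e)
      = y then pmf (W (snd (snd e))) k else 0) \<partial>measure_pmf P)"
      unfolding q_def split_beta pmf_bind[of P] one ..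
    also have "\<dots> = (\<Sum>(x', y', z)\<in>UNIV. (if x' = x \<and> y'
      = y then pmf (W z) k else 0) * pmf P (x', y', z))"
      by (subst integral_measure_pmf_real[of UNIV]) (auto simp: split_beta)
    also have "\<dots> = pmf P (x, y, Some False) * a k + pmf P (x, y, Some True) * b k
      + pmf P (x, y, None) * c k"
      unfolding UNIV_bool_bool_option
        by (cases x; cases y) (simp_all add: a_def b_def c_def sum.cartesian_product[symmetric] algebra_simps)
    finally show ?thesis .
  qed
  define p0 where "p0 k = 5 * (a k + c k) / 36" for k
  define p1 where "p1 k = (2 * a k + 2 * b k + 4 * c k) / 36" for k
  define p2 where "p2 k = 5 * (b k + c k) / 36" for k
  have qs: "pmf q (False, False, k) = p0 k" "pmf q (False, True, k)
    = p1 k" "pmf q (True, False, k) = p1 k" "pmf q (True, True, k) = p2 k" for k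
    by (simp_all add: q M0 M1 Mbot p0_def p1_def p2_def field_simps)
  have setq: "set_pmf q \<subseteq> UNIV \<times> UNIV \<times> S" by (auto simp: q_def S_def)
  have finq: "finite (set_pmf q)" by (rule finite_subset[OF setq]) (simp add: finS)
  have cz: "cell q (snd \<circ> snd) (x, y, k) = p0 k + 2 * p1 k + p2 k" for x y k
  proof -
    have "{e. (snd \<circ> snd) e = (snd \<circ> snd) (x, y, k)}
      = {(False, False, k), (False, True, k), (True, False, k), (True, True, k)}"
      by (auto simp: o_def)
    then show ?thesis by (simp add: cell_def measure_measure_pmf_finite qs)
  qed
  have cx: "cell q (\<lambda>e. (fst e, (snd \<circ> snd) e)) (x, y, k) = (if x then p1 k + p2 k else p0 k
    + p1 k)" for x y k
  proof -
    have "{e. (fst e, (snd \<circ> snd) e) = (fst (x, y, k), (snd \<circ> snd) (x, y, k))}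
      = {(x, False, k), (x, True, k)}"
      by (auto simp: o_def)
    then show ?thesis by (cases x) (simp_all add: cell_def measure_measure_pmf_finite qs)
  qed
  have cy: "cell q (\<lambda>e. ((fst \<circ> snd) e, (snd \<circ> snd) e)) (x, y, k) = (if y then p1 k
    + p2 k else p0 k + p1 k)" for x y k
  proof -
    have "{e. ((fst \<circ> snd) e, (snd \<circ> snd) e) = ((fst \<circ> snd) (x, y, k), (snd \<circ> snd) (x, y, k))}
      = {(False, y, k), (True, y, k)}"
      by (auto simp: o_def)
    then show ?thesis by (cases y) (simp_all add: cell_def measure_measure_pmf_finite qs)
  qed
  have c: "cell q (\<lambda>e. (fst e, (fst \<circ> snd) e, (snd \<circ> snd) e)) e = pmf q e" for e
    by (simp add: cell_def measure_pmf_single[symmetric] prod_eq_iff[symmetric])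
  have split: "(\<Sum>e\<in>UNIV \<times> UNIV \<times> S. f e) = (\<Sum>k\<in>S. f (False, False, k) + f (False, True, k)
    + (f (True, False, k) + f (True, True, k)))"
    for f :: "bool \<times> bool \<times> 'b \<Rightarrow> real"
    by (simp add: sum.cartesian_product' UNIV_bool sum.distrib)
  \<comment> \<open>Points outside the support contribute 0, so the sum may run over the whole
    product and be split by output letters.\<close>
  have "cmi q fst (fst \<circ> snd) (snd \<circ> snd) = (\<Sum>e\<in>UNIV \<times> UNIV \<times> S. pmf q e * (log 2 (pmf q e)
    + log 2 (cell q (snd \<circ> snd) e)
     - log 2 (cell q (\<lambda>e. (fst e, (snd \<circ> snd) e)) e)
       - log 2 (cell q (\<lambda>e. ((fst \<circ> snd) e, (snd \<circ> snd) e)) e)))"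
    unfolding cmi_eq_sum c using setq finS by (intro sum.mono_neutral_left) (auto simp: set_pmf_iff)
  also have "\<dots> = (\<Sum>k\<in>S. (p0 k * (ln (p0 k) + ln (p0 k + 2 * p1 k + p2 k) - ln (p0 k + p1 k)
    - ln (p0 k + p1 k))
     + 2 * (p1 k * (ln (p1 k) + ln (p0 k + 2 * p1 k + p2 k) - ln (p0 k + p1 k) - ln (p1 k + p2 k)))
     + p2 k * (ln (p2 k) + ln (p0 k + 2 * p1 k + p2 k) - ln (p1 k + p2 k) - ln (p1 k + p2 k)))) / ln 2"
    unfolding split cz cx cy qs sum_divide_distrib
    by (intro sum.cong refl) (simp add: log_def add_divide_distrib diff_divide_distrib algebra_simps)
  also have "\<dots> \<ge> (\<Sum>k\<in>S. (64 / 1296\<^sup>2) * (9/8 * (3 * c k - a k - b k) - 9/64 * (a k + b k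
    + 2 * c k))) / ln 2"
    unfolding p0_def p1_def p2_def
    by (intro divide_right_mono sum_mono letter_bound) (auto simp: a_def b_def c_def)
  also have "(\<Sum>k\<in>S. (64 / 1296\<^sup>2) * (9/8 * (3 * c k - a k - b k) - 9/64 * (a k + b k + 2 * c k)))
    = (64 / 1296\<^sup>2) * (9/8 * (3 * sum c S - sum a S - sum b S) - 9/64 * (sum a S + sum b S
      + 2 * sum c S))"
    unfolding sum_distrib_left[symmetric]
    by (simp add: sum.distrib sum_subtractf sum_divide_distrib[symmetric] sum_distrib_left[symmetric])
  \<comment> \<open>Each input's output probabilities sum to 1, which turns the linear bound into
    the constant 9/16.\<close>
  also have "sum a S = 1" unfolding a_def using finS by (intro sum_pmf_eq_1) (auto simp: S_def)
  also have "sum b S = 1" unfolding b_def using finS by (intro sum_pmf_eq_1) (auto simp: S_def)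
  also have "sum c S = 1" unfolding c_def using finS by (intro sum_pmf_eq_1) (auto simp: S_def)
  finally have "cmi q fst (fst \<circ> snd) (snd \<circ> snd) \<ge> (64 / 1296\<^sup>2) * (9/8 * (3 * 1 - 1 - 1)
    - 9/64 * (1 + 1 + 2 * 1)) / ln 2" .
  moreover have "9/8 * (3 * 1 - 1 - 1) - 9/64 * (1 + 1 + 2 * 1) = (9/16 :: real)" by simp
  ultimately show ?thesis unfolding q_def by (simp only:)
qed

lemma intrinsic_information_pos: "0 < intrinsic_information P"
proof -
  let ?q = "\<lambda>W. do { (x, y, z) \<leftarrow> P; z' \<leftarrow> W z; return_pmf (x, y, z') }"
  have "ereal ((64 / 1296\<^sup>2) * (9/16) / ln 2) \<le> intrinsic_information P"
    unfolding intrinsic_information_def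
  proof (rule INF_greatest)
    fix W :: "bool option \<Rightarrow> nat pmf" assume "W \<in> {W. finite_channel W}"
    then have W: "finite (set_pmf (W z))" for z by (auto simp: finite_channel_def)
    have fin: "finite (set_pmf (?q W))"
      by (auto simp: split_beta W)
    show "ereal ((64 / 1296\<^sup>2) * (9/16) / ln 2)
      \<le> ereal (cond_mutual_info2 (?q W) fst (fst \<circ> snd) (snd \<circ> snd))"
      unfolding cond_mutual_info2_eq_cmi[OF fin] using intrinsic_lower_bound[of W] W by simp
  qed
  then show ?thesis by (rule less_le_trans[rotated]) simp
qed

end

section \<open>The formation cost\<close>

text \<open>
  The flag marks the common part of two laws: on the flag \<open>True\<close>, \<open>flagged p q\<close> and \<open>flagged q p\<close>
  coincide, and \<open>False\<close> has probability at most the total variation distance. As the flag is a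
  single bit, conditioning on it changes a conditional mutual information by at most 1.
\<close>

definition flagged :: "'a pmf \<Rightarrow> 'a pmf \<Rightarrow> (bool \<times> 'a) pmf" where
  "flagged p q = bind_pmf p (\<lambda>a. map_pmf (\<lambda>b. (b, a)) (bernoulli_pmf (min (pmf p a) (pmf q a) / pmf
    p a)))"

lemma pmf_flagged:
  "pmf (flagged p q) (True, a) = min (pmf p a) (pmf q a)"
  "pmf (flagged p q) (False, a) = pmf p a - min (pmf p a) (pmf q a)"
proof -
  have r: "0 \<le> min (pmf p a) (pmf q a) / pmf p a" "min (pmf p a) (pmf q a) / pmf p a \<le> 1"
    by (auto simp: divide_le_eq)
  show "pmf (flagged p q) (True, a) = min (pmf p a) (pmf q a)"
    unfolding flagged_def pmf_bind_tagged using r by (cases "pmf p a = 0") auto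
  show "pmf (flagged p q) (False, a) = pmf p a - min (pmf p a) (pmf q a)"
    unfolding flagged_def pmf_bind_tagged using r by (cases "pmf p a = 0") (auto simp: algebra_simps)
qed

lemma map_snd_flagged: "map_pmf snd (flagged p q) = p"
  by (simp add: flagged_def map_bind_pmf map_pmf_comp bind_return_pmf')

lemma finite_flagged: "finite (set_pmf p) \<Longrightarrow> finite (set_pmf (flagged p q))"
  by (simp add: flagged_def)

section \<open>Continuity of conditional mutual information in total variation\<close>

lemma prob_eq_if_pmf_eq:
  assumes "\<And>a. a \<in> A \<Longrightarrow> pmf p a = pmf q a"
  shows "measure_pmf.prob p A = measure_pmf.prob q A"
  unfolding measure_pmf_conv_infsetsum using assms by (intro infsetsum_cong) auto

lemma tv_dist_ge: "measure_pmf.prob q A - measure_pmf.prob p A \<le> tv_dist p q"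
proof -
  have "\<bar>measure_pmf.prob p A - measure_pmf.prob q A\<bar> \<le> tv_dist p q"
    unfolding tv_dist_def
  proof (rule cSUP_upper)
    show "bdd_above (range (\<lambda>A. \<bar>measure_pmf.prob p A - measure_pmf.prob q A\<bar>))"
    proof (rule bdd_aboveI2)
      fix A show "\<bar>measure_pmf.prob p A - measure_pmf.prob q A\<bar> \<le> 1"
        using measure_pmf.prob_le_1[of p A] measure_pmf.prob_le_1[of q A]
          measure_nonneg[of "measure_pmf p" A] measure_nonneg[of "measure_pmf q" A] by linarith
    qed
  qed simp
  then show ?thesis by linarith
qed

text \<open>The flag is \<open>False\<close> with the total excess of \<open>q\<close> over
  \<open>p\<close>, which is the difference of their probabilities on the set where \<open>q\<close>
  is larger.\<close>

lemma prob_flagged_False: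
  assumes fin: "finite (set_pmf q)"
  shows "measure_pmf.prob (flagged q p) {a. \<not> fst a} \<le> tv_dist p q"
proof -
  define A where "A = {a\<in>set_pmf q. pmf p a < pmf q a}"
  have finA: "finite A" using fin by (simp add: A_def)
  have "measure_pmf.prob (flagged q p) {a. \<not> fst a}
    = measure_pmf.prob (flagged q p) ({a. \<not> fst a} \<inter> set_pmf (flagged q p))"
    by (simp add: measure_Int_set_pmf)
  also have "{a. \<not> fst a} \<inter> set_pmf (flagged q p) = Pair False ` A"
  proof -
    have "a \<in> set_pmf q" if "pmf p a < pmf q a" for a
      using that pmf_nonneg[of p a] by (auto simp: set_pmf_iff simp del: pmf_nonneg)
    then show ?thesis by (auto simp: set_pmf_iff pmf_flagged A_def min_def split: if_splits)
  qed
  also have "measure_pmf.prob (flagged q p) (Pair False ` A) = (\<Sum>a\<in>A. pmf q a - pmf p a)"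
    using finA by (subst measure_measure_pmf_finite)
      (auto simp: sum.reindex inj_on_def pmf_flagged A_def intro!: sum.cong)
  also have "\<dots> = measure_pmf.prob q A - measure_pmf.prob p A"
    using finA by (simp add: measure_measure_pmf_finite sum_subtractf)
  also have "\<dots> \<le> tv_dist p q" by (rule tv_dist_ge)
  finally show ?thesis .
qed

text \<open>Conditioning on the flags costs at most 1 for each law. The parts flagged
  \<open>True\<close> then agree, the other part is nonnegative for \<open>p\<close>, and for
  \<open>q\<close> it is at most the total variation distance times \<open>log 2 (card K)\<close>.
  Only the alphabet of \<open>X\<close> enters, so transcripts may be arbitrarily long.\<close>

lemma cmi_continuity:
  fixes p q :: "'a pmf"
  assumes finp: "finite (set_pmf p)" and finq: "finite (set_pmf q)"
    and K: "finite K" "\<And>a. a \<in> set_pmf q \<Longrightarrow> X a \<in> K" "K \<noteq> {}"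
  shows "cmi q X Y Z \<le> cmi p X Y Z + tv_dist p q * log 2 (card K) + 2"
proof -
  let ?p = "flagged p q" and ?q = "flagged q p"
  let ?X = "\<lambda>a. X (snd a)" and ?Y = "\<lambda>a. Y (snd a)" and ?Z = "\<lambda>a. (Z (snd a), fst a)"
  have finp': "finite (set_pmf ?p)" and finq': "finite (set_pmf ?q)" using finp finq
    by (simp_all add: finite_flagged)
  define t where "t r a = pmf r a * (log 2 (cell r (\<lambda>a. (?X a, ?Y a, ?Z a)) a) + log 2 (cell r ?Z a)
     - log 2 (cell r (\<lambda>a. (?X a, ?Z a)) a)
       - log 2 (cell r (\<lambda>a. (?Y a, ?Z a)) a))" for r :: "(bool \<times> 'a) pmf" and a
  have cp: "cmi p X Y Z = cmi ?p ?X ?Y (\<lambda>a. Z (snd a))"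
    using cmi_map[OF finp', of snd X Y Z] by (simp add: map_snd_flagged)
  have cq: "cmi q X Y Z = cmi ?q ?X ?Y (\<lambda>a. Z (snd a))"
    using cmi_map[OF finq', of snd X Y Z] by (simp add: map_snd_flagged)
  have split: "cmi r ?X ?Y ?Z = (\<Sum>a\<in>{a\<in>set_pmf r. fst a}. t r a)
    + (\<Sum>a\<in>{a\<in>set_pmf r. \<not> fst a}. t r a)"
    if fin: "finite (set_pmf r)" for r :: "(bool \<times> 'a) pmf"
  proof -
    have "set_pmf r = {a\<in>set_pmf r. fst a} \<union> {a\<in>set_pmf r. \<not> fst a}" by auto
    then have "(\<Sum>a\<in>set_pmf r. t r a)
      = (\<Sum>a\<in>{a\<in>set_pmf r. fst a} \<union> {a\<in>set_pmf r. \<not> fst a}. t r a)" by simp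
    also have "\<dots> = (\<Sum>a\<in>{a\<in>set_pmf r. fst a}. t r a) + (\<Sum>a\<in>{a\<in>set_pmf r. \<not> fst a}. t r a)"
      using fin by (intro sum.union_disjoint) auto
    finally show ?thesis by (simp add: cmi_eq_sum t_def)
  qed
  have pm: "pmf ?p a = pmf ?q a" if "fst a" for a
    using that by (cases a) (simp add: pmf_flagged min.commute)
  have True_part: "(\<Sum>a\<in>{a\<in>set_pmf ?p. fst a}. t ?p a) = (\<Sum>a\<in>{a\<in>set_pmf ?q. fst a}. t ?q a)"
  proof (rule sum.cong)
    show "{a\<in>set_pmf ?p. fst a} = {a\<in>set_pmf ?q. fst a}" by (auto simp: set_pmf_iff pm)
    fix a assume "a \<in> {a\<in>set_pmf ?q. fst a}"
    then have a: "fst a" by simp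
    \<comment> \<open>A variable that determines the flag has its cells inside one flag value, so on
      \<open>True\<close> the two laws give them the same probability.\<close>
    have "cell ?p F a = cell ?q F a" if "\<And>b. F b = F a \<Longrightarrow> fst b = fst a" for F :: "_ \<Rightarrow> 'g"
      unfolding cell_def
    proof (rule prob_eq_if_pmf_eq, rule pm)
      fix b assume "b \<in> {b. F b = F a}"
      then show "fst b" using that[of b] a by simp
    qed
    note c = this
    have "cell ?p (\<lambda>a. (?X a, ?Y a, ?Z a)) a = cell ?q (\<lambda>a. (?X a, ?Y a, ?Z a)) a"
      "cell ?p ?Z a = cell ?q ?Z a" "cell ?p (\<lambda>a. (?X a, ?Z a)) a = cell ?q (\<lambda>a. (?X a, ?Z a)) a"
      "cell ?p (\<lambda>a. (?Y a, ?Z a)) a = cell ?q (\<lambda>a. (?Y a, ?Z a)) a"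
      by (rule c; simp)+
    then show "t ?p a = t ?q a" by (simp add: t_def pm[OF a])
  qed
  have Fp: "0 \<le> (\<Sum>a\<in>{a\<in>set_pmf ?p. \<not> fst a}. t ?p a)"
    unfolding t_def by (rule cmi_part_nonneg[OF finp']) auto
  have "(\<Sum>a\<in>{a\<in>set_pmf ?q. \<not> fst a}. t ?q a)
    \<le> (\<Sum>a\<in>{a\<in>set_pmf ?q. \<not> fst a}. pmf ?q a * (log 2 (cell ?q ?Z a)
      - log 2 (cell ?q (\<lambda>a. (?X a, ?Z a)) a)))"
    unfolding t_def
  proof (intro sum_mono mult_left_mono pmf_nonneg)
    fix a assume "a \<in> {a\<in>set_pmf ?q. \<not> fst a}"
    then have a: "a \<in> set_pmf ?q" by simp
    have "cell ?q (\<lambda>a. (?X a, ?Y a, ?Z a)) a \<le> cell ?q (\<lambda>a. (?Y a, ?Z a)) a"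
      by (rule cell_mono) auto
    then have "log 2 (cell ?q (\<lambda>a. (?X a, ?Y a, ?Z a)) a) \<le> log 2 (cell ?q (\<lambda>a. (?Y a, ?Z a)) a)"
      using cell_pos[OF a] by (intro log_mono) auto
    then show "log 2 (cell ?q (\<lambda>a. (?X a, ?Y a, ?Z a)) a) + log 2 (cell ?q ?Z a)
     - log 2 (cell ?q (\<lambda>a. (?X a, ?Z a)) a) - log 2 (cell ?q (\<lambda>a. (?Y a, ?Z a)) a)
      \<le> log 2 (cell ?q ?Z a) - log 2 (cell ?q (\<lambda>a. (?X a, ?Z a)) a)" by simp
  qed
  also have "\<dots> \<le> measure_pmf.prob ?q {a\<in>set_pmf ?q. \<not> fst a} * log 2 (card K)"
  proof (rule cond_ent_part_le[OF finq'])
    fix a assume "a \<in> {a\<in>set_pmf ?q. \<not> fst a}"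
    then have "snd a \<in> set_pmf (map_pmf snd ?q)" by auto
    then show "X (snd a) \<in> K" unfolding map_snd_flagged by (rule K(2))
  qed (auto simp: K)
  also have "measure_pmf.prob ?q {a\<in>set_pmf ?q. \<not> fst a} = measure_pmf.prob ?q {a. \<not> fst a}"
    by (subst (2) measure_Int_set_pmf[symmetric]) (auto intro!: arg_cong2[where f=measure])
  also have "measure_pmf.prob ?q {a. \<not> fst a} * log 2 (card K) \<le> tv_dist p q * log 2 (card K)"
  proof (intro mult_right_mono prob_flagged_False finq)
    have "card K \<noteq> 0" using K by auto
    then show "0 \<le> log 2 (real (card K))" by simp
  qed
  finally have Fq: "(\<Sum>a\<in>{a\<in>set_pmf ?q. \<not> fst a}. t ?q a) \<le> tv_dist p q * log 2 (card K)" .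
  have "cmi ?q ?X ?Y (\<lambda>a. Z (snd a)) \<le> cmi ?q ?X ?Y ?Z + 1" by (rule cmi_condition_bit[OF finq'])
  moreover have "cmi ?p ?X ?Y ?Z \<le> cmi ?p ?X ?Y (\<lambda>a. Z (snd a)) + 1"
    by (rule cmi_condition_bit[OF finp'])
  ultimately show ?thesis using split[OF finp'] split[OF finq'] True_part Fp Fq unfolding cp cq by linarith
qed

text \<open>Before the discussion the views share only the secret \<open>u\<close>, whose entropy is
  at most \<open>k\<close>, and the discussion cannot increase their information.\<close>

lemma cmi_formation_law_le:
  assumes rnd: "finite_randomness \<pi>"
  shows "cmi (formation_law k \<pi>) fst (\<lambda>a. fst (snd a)) (\<lambda>a. snd (snd a)) \<le> k"
proof -
  let ?U = "pmf_of_set {u :: bool list. length u = k}"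
  have ne: "{u :: bool list. length u = k} \<noteq> {}" using length_replicate[of k True] by blast
  have finU: "finite {u :: bool list. length u = k}"
    using finite_lists_length_eq[of "UNIV :: bool set" k] by simp
  have cardU: "card {u :: bool list. length u = k} = 2 ^ k"
    using card_lists_length_eq[of "UNIV :: bool set" k] by simp
  define p where "p = do { u \<leftarrow> ?U; a \<leftarrow> pair_pmf (return_pmf u) (rand_A \<pi>);
    b \<leftarrow> pair_pmf (return_pmf u) (rand_B \<pi>); return_pmf (a, b, u) }"
  define C where "C = (\<lambda>a :: (bool list \<times> nat) \<times> (bool list \<times> nat) \<times> bool list. transcript
    (messages \<pi>) (fst (fst a)) (snd (fst a)) (fst (fst (snd a))) (snd (fst (snd a))) [])"
  have finp: "finite (set_pmf p)"
    using rnd finU by (simp add: p_def finite_randomness_def set_pmf_of_set[OF ne])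
  have supp: "fst (fst a) = snd (snd a) \<and> fst (fst (snd a)) = snd (snd a) \<and> length (snd (snd a))
    = k" if "a \<in> set_pmf p" for a
    using that by (auto simp: p_def set_pmf_of_set[OF ne finU])
  have law: "formation_law k \<pi>
    = map_pmf (\<lambda>a. (out_A \<pi> (fst (fst a)) (snd (fst a)) (C a), out_B \<pi> (fst (fst (snd a))) (snd
      (fst (snd a))) (C a), C a)) p"
    by (simp add: formation_law_def run_def p_def C_def pair_pmf_def map_bind_pmf bind_assoc_pmf
      bind_return_pmf Let_def)
  have "cmi (formation_law k \<pi>) fst (\<lambda>a. fst (snd a)) (\<lambda>a. snd (snd a))
    = cmi p (\<lambda>a. out_A \<pi> (fst (fst a)) (snd (fst a)) (C a)) (\<lambda>a. out_B \<pi> (fst (fst (snd a))) (snd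
      (fst (snd a))) (C a)) C"
    unfolding law cmi_map[OF finp] by simp
  also have "\<dots> = cmi p (\<lambda>a. out_A \<pi> (fst (fst a)) (snd (fst a)) (C a)) (\<lambda>a. out_B \<pi> (fst (fst (snd
    a))) (snd (fst (snd a))) (C a)) (\<lambda>a. ((), C a))"
    by (intro cmi_cong) auto
  also have "\<dots> \<le> cmi p fst (\<lambda>a. fst (snd a)) (\<lambda>a. ())"
    by (rule cmi_discussion_le[OF finp, where f="\<lambda>a. out_A \<pi> (fst a) (snd a)" and g="\<lambda>a. out_B \<pi>
      (fst a) (snd a)" and ms="messages \<pi>"])
      (simp add: C_def)
  also have "\<dots> \<le> k"
  proof -
    \<comment> \<open>Both views contain \<open>u\<close> and are independent given it, so their
      mutual information equals the entropy of \<open>u\<close>.\<close>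
    let ?u = "\<lambda>a. snd (snd a)"
    have "cmi p fst (\<lambda>a. fst (snd a)) ?u = 0" unfolding p_def by (rule cmi_conditionally_independent)
    moreover have "ent p (\<lambda>a. (fst a, ?u a)) = ent p (\<lambda>a. (fst a, ()))"
      "ent p (\<lambda>a. (fst (snd a), ?u a)) = ent p (\<lambda>a. (fst (snd a), ()))"
      "ent p (\<lambda>a. (fst a, fst (snd a), ?u a)) = ent p (\<lambda>a. (fst a, fst (snd a), ()))"
      by (intro ent_cong; metis supp prod.inject)+
    moreover have "ent p (\<lambda>_. ()) = 0" by (rule ent_const) simp
    moreover have "ent p ?u \<le> log 2 (card {u :: bool list. length u = k})"
      using supp by (intro ent_le_log_card finp finU) auto
    moreover have "log 2 (card {u :: bool list. length u = k}) = k" unfolding cardU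
      by (simp add: log_nat_power)
    ultimately show ?thesis by (simp add: cmi_def)
  qed
  finally show ?thesis .
qed

section \<open>Letter-by-letter lower bound for simulated transcripts\<close>

lemma cmi_list_chain:
  assumes "n \<le> N" and len: "\<And>a. a \<in> set_pmf p \<Longrightarrow> length (X a) = N"
  shows "cmi p (\<lambda>a. take n (X a)) Y C = (\<Sum>i<n. cmi p (\<lambda>a. X a ! i) Y (\<lambda>a. (C a, take i (X a))))"
  using assms(1)
proof (induction n)
  case 0
  have "ent p (\<lambda>a. (take 0 (X a), C a)) = ent p C" "ent p (\<lambda>a. (take 0 (X a), Y a, C a))
    = ent p (\<lambda>a. (Y a, C a))"
    by (intro ent_cong; auto)+
  then show ?case by (simp add: cmi_def)
next
  case (Suc n)
  have "cmi p (\<lambda>a. take (Suc n) (X a)) Y C = cmi p (\<lambda>a. (take n (X a), X a ! n)) Y C"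
    using Suc.prems len by (intro cmi_cong) (auto simp: take_Suc_conv_app_nth)
  also have "\<dots> = cmi p (\<lambda>a. take n (X a)) Y C + cmi p (\<lambda>a. X a ! n) Y (\<lambda>a. (C a, take n (X a)))"
    unfolding cmi_commute[of p _ Y] by (rule cmi_chain)
  finally show ?case using Suc by simp
qed

text \<open>The other copies are independent of copy \<open>i\<close>, so the transcript together
  with the earlier \<open>X\<close>-letters arises from the \<open>i\<close>-th \<open>Z\<close>
  alone through a channel. Its output is coded by a natural number, as
  \<open>intrinsic_information\<close> requires.\<close>

lemma simulated_law_letter:
  fixes P :: "('x::finite \<times> 'y::finite \<times> 'z::finite) pmf"
  assumes i: "i < N"
  shows "map_pmf (\<lambda>e. (fst e ! i, fst (snd e) ! i, to_nat (snd (snd e), take i (fst e))))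
    (simulated_law P N Q)
    = do { (x, y, z) \<leftarrow> P; z' \<leftarrow> do { l1 \<leftarrow> replicate_pmf i P; l2 \<leftarrow> replicate_pmf (N - Suc i) P;
       c \<leftarrow> Q (map (snd \<circ> snd) l1 @ z # map (snd \<circ> snd) l2);
         return_pmf (to_nat (c, map fst l1)) }; return_pmf (x, y, z') }"
proof -
  have N: "N = i + Suc (N - Suc i)" using i by simp
  have rep: "replicate_pmf N P = do { l1 \<leftarrow> replicate_pmf i P; t \<leftarrow> P; l2 \<leftarrow> replicate_pmf (N
    - Suc i) P; return_pmf (l1 @ t # l2) }"
    by (subst N, subst replicate_pmf_distrib) (simp add: bind_assoc_pmf bind_return_pmf)
  have "map_pmf (\<lambda>e. (fst e ! i, fst (snd e) ! i, to_nat (snd (snd e), take i (fst e))))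
    (simulated_law P N Q)
    = do { l1 \<leftarrow> replicate_pmf i P; t \<leftarrow> P; l2 \<leftarrow> replicate_pmf (N - Suc i) P;
       c \<leftarrow> Q (map (snd \<circ> snd) l1 @ snd (snd t) # map (snd \<circ> snd) l2);
       return_pmf ((map fst l1 @ fst t # map fst l2) ! i, (map (fst \<circ> snd) l1 @ fst (snd t) # map
         (fst \<circ> snd) l2) ! i,
          to_nat (c, take i (map fst l1 @ fst t # map fst l2))) }"
    unfolding simulated_law_def rep by (simp add: map_bind_pmf bind_assoc_pmf bind_return_pmf)
  also have "\<dots> = do { l1 \<leftarrow> replicate_pmf i P; t \<leftarrow> P; l2 \<leftarrow> replicate_pmf (N - Suc i) P;
       c \<leftarrow> Q (map (snd \<circ> snd) l1 @ snd (snd t) # map (snd \<circ> snd) l2);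
       return_pmf (fst t, fst (snd t), to_nat (c, map fst l1)) }"
    by (intro bind_pmf_cong refl) (auto simp: set_replicate_pmf nth_append)
  also have "\<dots> = do { t \<leftarrow> P; l1 \<leftarrow> replicate_pmf i P; l2 \<leftarrow> replicate_pmf (N - Suc i) P;
       c \<leftarrow> Q (map (snd \<circ> snd) l1 @ snd (snd t) # map (snd \<circ> snd) l2);
       return_pmf (fst t, fst (snd t), to_nat (c, map fst l1)) }"
    by (rule bind_commute_pmf)
  also have "\<dots> = do { (x, y, z) \<leftarrow> P; z' \<leftarrow> do { l1 \<leftarrow> replicate_pmf i P; l2 \<leftarrow> replicate_pmf (N
    - Suc i) P;
       c \<leftarrow> Q (map (snd \<circ> snd) l1 @ z # map (snd \<circ> snd) l2);
         return_pmf (to_nat (c, map fst l1)) }; return_pmf (x, y, z') }"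
    by (intro bind_pmf_cong refl) (auto simp: bind_assoc_pmf bind_return_pmf)
  finally show ?thesis .
qed

lemma finite_simulated_law:
  fixes P :: "('x::finite \<times> 'y::finite \<times> 'z::finite) pmf"
  assumes "finite_channel Q"
  shows "finite (set_pmf (simulated_law P N Q))"
  using assms finite_replicate_pmf[of P N] by (simp add: simulated_law_def finite_channel_def)

text \<open>The chain rule runs over the letters of \<open>X\<close>. In each term the list of
  \<open>Y\<close>-letters is reduced to its \<open>i\<close>-th entry by data processing, and what
  remains is one of the values in the infimum defining the intrinsic information.\<close>

lemma cmi_simulated_law_ge:
  fixes P :: "('x::finite \<times> 'y::finite \<times> 'z::finite) pmf"
  assumes Q: "finite_channel Q"
    and L: "ereal L \<le> intrinsic_information P"
  shows "N * L \<le> cmi (simulated_law P N Q) fst (\<lambda>e. fst (snd e)) (\<lambda>e. snd (snd e))"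
proof -
  let ?s = "simulated_law P N Q"
  have fin: "finite (set_pmf ?s)" by (rule finite_simulated_law[OF Q])
  have len: "length (fst e) = N" "length (fst (snd e)) = N" if "e \<in> set_pmf ?s" for e
    using that by (auto simp: simulated_law_def set_replicate_pmf)
  have letter: "L \<le> cmi ?s (\<lambda>e. fst e ! i) (\<lambda>e. fst (snd e)) (\<lambda>e. (snd (snd e), take i (fst e)))"
    if i: "i < N" for i
  proof -
    define W where "W z = do { l1 \<leftarrow> replicate_pmf i P; l2 \<leftarrow> replicate_pmf (N - Suc i) P;
       c \<leftarrow> Q (map (snd \<circ> snd) l1 @ z # map (snd \<circ> snd) l2);
         return_pmf (to_nat (c, map fst l1)) }" for z
    let ?q = "do { (x, y, z) \<leftarrow> P; z' \<leftarrow> W z; return_pmf (x, y, z') }"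
    have W: "finite_channel W"
      using Q by (simp add: finite_channel_def W_def finite_replicate_pmf)
    have finq: "finite (set_pmf ?q)" using W by (auto simp: split_beta finite_channel_def)
    have law: "map_pmf (\<lambda>e. (fst e ! i, fst (snd e) ! i, to_nat (snd (snd e), take i (fst e)))) ?s
      = ?q"
      unfolding W_def by (rule simulated_law_letter[OF i])
    have "ereal L \<le> ereal (cond_mutual_info2 ?q fst (fst \<circ> snd) (snd \<circ> snd))"
      by (rule order_trans[OF L]) (unfold intrinsic_information_def, rule INF_lower, simp add: W)
    then have "L \<le> cmi ?q fst (fst \<circ> snd) (snd \<circ> snd)"
      by (simp add: cond_mutual_info2_eq_cmi[OF finq])
    also have "\<dots> = cmi ?s (\<lambda>e. fst e ! i) (\<lambda>e. fst (snd e) ! i) (\<lambda>e. (snd (snd e), take i (fst e)))"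
      unfolding law[symmetric] cmi_map[OF fin] by (intro cmi_cong) auto
    also have "\<dots> = cmi ?s (\<lambda>e. fst (snd e) ! i) (\<lambda>e. fst e ! i) (\<lambda>e. (snd (snd e), take i (fst
      e)))" by (rule cmi_commute)
    also have "\<dots> \<le> cmi ?s (\<lambda>e. fst (snd e)) (\<lambda>e. fst e ! i) (\<lambda>e. (snd (snd e), take i (fst e)))"
      by (rule cmi_data_processing[OF fin]) auto
    also have "\<dots> = cmi ?s (\<lambda>e. fst e ! i) (\<lambda>e. fst (snd e)) (\<lambda>e. (snd (snd e), take i (fst e)))"
      by (rule cmi_commute)
    finally show ?thesis .
  qed
  have "N * L = (\<Sum>i<N. L)" by simp
  also have "\<dots> \<le> (\<Sum>i<N. cmi ?s (\<lambda>e. fst e ! i) (\<lambda>e. fst (snd e)) (\<lambda>e. (snd (snd e), take i (fst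
    e))))"
    by (intro sum_mono letter) auto
  also have "\<dots> = cmi ?s (\<lambda>e. take N (fst e)) (\<lambda>e. fst (snd e)) (\<lambda>e. snd (snd e))"
    by (rule cmi_list_chain[symmetric, where N=N]) (auto simp: len)
  also have "\<dots> = cmi ?s fst (\<lambda>e. fst (snd e)) (\<lambda>e. snd (snd e))"
    by (intro cmi_cong) (auto simp: len)
  finally show ?thesis .
qed

text \<open>This holds for every finite source. A rate \<open>R\<close> below the intrinsic
  information would give, after division by \<open>N\<close>, information above \<open>R\<close>
  from secret bits of rate \<open>R\<close>, up to errors that are small for large
  \<open>N\<close>.\<close>

theorem intrinsic_information_le_formation_cost:
  fixes P :: "('x::finite \<times> 'y::finite \<times> 'z::finite) pmf"
  shows "intrinsic_information P \<le> formation_cost P"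
  unfolding formation_cost_def
proof (rule Inf_greatest, clarify)
  fix R :: real assume R: "0 \<le> R" "formation_achievable P R"
  show "intrinsic_information P \<le> ereal R"
  proof (rule ccontr)
    assume "\<not> intrinsic_information P \<le> ereal R"
    then obtain L where L: "R < L" "ereal L < intrinsic_information P"
      using ereal_dense2[of "ereal R" "intrinsic_information P"] by (auto simp: not_le)
    define c where "c = log 2 (CARD('x))"
    have c: "0 \<le> c" unfolding c_def using zero_less_card_finite[where 'a='x] by simp
    \<comment> \<open>Chosen so that the continuity error per letter, \<open>\<epsilon> * c\<close>,
      is at most half the gap \<open>L - R\<close>; the summand 1 keeps the denominator positive
      when \<open>c = 0\<close>.\<close>
    define \<epsilon> where "\<epsilon> = (L - R) / (2 * (1 + c))"
    have \<epsilon>: "0 < \<epsilon>" using L c by (simp add: \<epsilon>_def)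
    have ec: "\<epsilon> * c \<le> (L - R) / 2" using L c by (simp add: \<epsilon>_def field_simps)
    have "\<forall>\<^sub>F N in sequentially. real N > 4 / (L - R)"
      using filterlim_real_sequentially by (simp add: filterlim_at_top_dense)
    moreover have "\<forall>\<^sub>F N in sequentially. \<exists>(\<pi> :: (bool list, bool list, 'x list, 'y list) protocol)
      Q.
          finite_randomness \<pi>
          \<and> (\<forall>a r c. length (out_A \<pi> a r c) = N) \<and> (\<forall>b s c. length (out_B \<pi> b s c) = N)
          \<and> finite_channel Q
          \<and> tv_dist (formation_law (nat \<lfloor>R * real N\<rfloor>) \<pi>) (simulated_law P N Q) \<le> \<epsilon>"
      using R(2) \<epsilon> unfolding formation_achievable_def by blast
    ultimately have "\<forall>\<^sub>F N in sequentially. False"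
    proof eventually_elim
      case (elim N)
      then obtain \<pi> :: "(bool list, bool list, 'x list, 'y list) protocol" and Q where
        rnd: "finite_randomness \<pi>" and Q: "finite_channel Q"
        and tv: "tv_dist (formation_law (nat \<lfloor>R * real N\<rfloor>) \<pi>) (simulated_law P N Q) \<le> \<epsilon>" by blast
      let ?f = "formation_law (nat \<lfloor>R * real N\<rfloor>) \<pi>" and ?s = "simulated_law P N Q"
      let ?K = "{xs :: 'x list. length xs = N}"
      have finU: "finite {u :: bool list. length u = k}" for k
        using finite_lists_length_eq[of "UNIV :: bool set" k] by simp
      have neU: "{u :: bool list. length u = k} \<noteq> {}" for k using length_replicate[of k True] by blast
      have finf: "finite (set_pmf ?f)"
        using rnd by (simp add: formation_law_def run_def finite_randomness_def set_pmf_of_set[OF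
          neU finU] Let_def finU)
      have K: "finite ?K" "card ?K = CARD('x) ^ N"
        using finite_lists_length_eq[of "UNIV :: 'x set" N] card_lists_length_eq[of "UNIV :: 'x
          set" N] by simp_all
      have "cmi ?s fst (\<lambda>e. fst (snd e)) (\<lambda>e. snd (snd e))
        \<le> cmi ?f fst (\<lambda>e. fst (snd e)) (\<lambda>e. snd (snd e)) + tv_dist ?f ?s * log 2 (card ?K) + 2"
      proof (rule cmi_continuity[OF finf finite_simulated_law[OF Q] K(1)])
        show "fst e \<in> ?K" if "e \<in> set_pmf ?s" for e using that
          by (auto simp: simulated_law_def set_replicate_pmf)
        show "?K \<noteq> {}" by (auto intro!: exI[of _ "replicate N undefined"])
      qed
      moreover have "N * L \<le> cmi ?s fst (\<lambda>e. fst (snd e)) (\<lambda>e. snd (snd e))"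
        using L by (intro cmi_simulated_law_ge Q) simp
      moreover have "cmi ?f fst (\<lambda>e. fst (snd e)) (\<lambda>e. snd (snd e)) \<le> nat \<lfloor>R * real N\<rfloor>"
        by (rule cmi_formation_law_le[OF rnd])
      moreover have "real (nat \<lfloor>R * real N\<rfloor>) \<le> R * N" using R by simp
      moreover have "tv_dist ?f ?s * log 2 (card ?K) \<le> N * ((L - R) / 2)"
      proof -
        have lg: "log 2 (card ?K) = N * c" unfolding K(2) c_def by (simp add: log_nat_power)
        have "tv_dist ?f ?s * log 2 (card ?K) \<le> \<epsilon> * (N * c)" unfolding lg using tv c
          by (intro mult_right_mono) auto
        also have "\<dots> = N * (\<epsilon> * c)" by simp
        also have "\<dots> \<le> N * ((L - R) / 2)" using ec by (intro mult_left_mono) auto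
        finally show ?thesis .
      qed
      \<comment> \<open>Half of the gap survives, so \<open>N * (L - R) \<le> 4\<close>, against the
        choice of \<open>N\<close>.\<close>
      ultimately have "N * L \<le> R * N + N * ((L - R) / 2) + 2" by linarith
      moreover have "x - y \<le> 4" if "x \<le> y + (x - y) / 2 + 2" for x y :: real using that
        by (simp add: field_simps)
      ultimately have "N * (L - R) \<le> 4" by (simp add: algebra_simps diff_divide_distrib)
      moreover have "N * (L - R) > 4" using elim L by (simp add: field_simps)
      ultimately show ?case by simp
    qed
    then show False by simp
  qed
qed

(* X and Y take the values 0 = False and 1 = True; Z takes the values 0 = Some False,
   1 = Some True and bottom = None. *)
theorem theorem1:
  fixes P :: "(bool \<times> bool \<times> bool option) pmf"
  assumes M0: "\<And>x y. pmf P (x, y, Some False) = [[5, 2], [2, 0]] ! of_bool x ! of_bool y / 36"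
    and M1: "\<And>x y. pmf P (x, y, Some True) = [[0, 2], [2, 5]] ! of_bool x ! of_bool y / 36"
    and Mbot: "\<And>x y. pmf P (x, y, None) = [[5, 4], [4, 5]] ! of_bool x ! of_bool y / 36"
  shows "secret_key_rate P = 0
    \<and> 0 < intrinsic_information P
    \<and> intrinsic_information P \<le> formation_cost P"
proof -
  interpret source P
    by unfold_locales (fact M0 M1 Mbot)+
  show ?thesis
    using secret_key_rate_eq_0 intrinsic_information_pos intrinsic_information_le_formation_cost by blast
qed

end
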